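(* For $n\in\mathbb{N}$ (that is, $n\geq 1$) let $$\mathcal{C}_n:=\left\{x^3-x\langle y,y\rangle+P_3(y)\ \middle|\ P_3\in\mathrm{Sym}^3(\mathbb{R}^n)^*,\ \max_{\|y\|=1}P_3(y)\leq\frac{2}{3\sqrt{3}}\right\}.$$ Then the following hold. (1) $\mathcal{C}_n$ is a generating set for the moduli set of $n$-dimensional closed connected PSR manifolds under the action of $\mathrm{GL}(n+1)$. That is: for every closed connected PSR manifold $\mathcal{H}$ of dimension $n$ there exists $\widetilde{h}\in\mathcal{C}_n$ such that the connected component $\widetilde{\mathcal{H}}$ of $\{\widetilde{h}=1\}\subset\mathbb{R}^{n+1}$ containing the point $(x,y)=(1,0)$ is a closed connected PSR manifold equivalent to $\mathcal{H}$; and, conversely, for each $h\in\mathcal{C}_n$ the connected component of $\{h=1\}$ containing $(x,y)=(1,0)$ is a closed connected PSR manifold. (2) $\mathcal{C}_n\subset\mathrm{Sym}^3(\mathbb{R}^{n+1})^*$ is a uniformly bounded, compact, convex subset of the $\frac{n^3+3n^2+2n}{6}$-dimensional affine subspace $$\left\{x^3-x\langle y,y\rangle+P_3(y)\ \middle|\ P_3\in\mathrm{Sym}^3(\mathbb{R}^n)^*\right\}\subset\mathrm{Sym}^3(\mathbb{R}^{n+1})^*.$$ (3) The boundary $\partial\mathcal{C}_n$ of $\mathcal{C}_n$ (taken relative to the affine subspace in (2)) is a continuous (i.e. topological) submanifold of $\mathrm{Sym}^3(\mathbb{R}^{n+1})^*$. (4) If $\mathcal{H}$ is an $n$-dimensional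 closed connected PSR manifold and $\widetilde{h}\in\mathcal{C}_n$ corresponds to $\mathcal{H}$ as in (1), then $\widetilde{h}\in\partial\mathcal{C}_n$ if and only if $\mathcal{H}$ does not have regular boundary behaviour.
   Context: Write linear coordinates on $\mathbb{R}^{n+1}$ as $(x,y)=(x,y_1,\ldots,y_n)$; $\langle\cdot,\cdot\rangle$ and $\|\cdot\|$ denote the standard Euclidean scalar product and norm on $\mathbb{R}^n$ in the coordinates $y$. $\mathrm{Sym}^3(\mathbb{R}^m)^*$ is the finite-dimensional real vector space of homogeneous cubic polynomials on $\mathbb{R}^m$ with its standard topology. Let $h:\mathbb{R}^{n+1}\to\mathbb{R}$ be a homogeneous cubic polynomial and $\partial^2h_p$ its Hessian bilinear form at $p$. A point $p$ with $h(p)>0$ is a hyperbolic point of $h$ if $-\partial^2h_p$ has signature $(n,1)$ ($n$ positive, one negative direction). An $n$-dimensional PSR (projective special real) manifold is a nonempty (relatively) open subset $\mathcal{H}$ of a level set $\{h=1\}\subset\mathbb{R}^{n+1}$ of such an $h$, consisting only of hyperbolic points of $h$. It is a closed connected PSR manifold (CCPSR manifold) if it is connected and closed as a subset of $\mathbb{R}^{n+1}$. Two closed connected PSR manifolds $\mathcal{H}\subset\{h=1\}$ and $\overline{\mathcal{H}}\subset\{\overline{h}=1\}$ in $\mathbb{R}^{n+1}$ are equivalent if there is $A\in\mathrm{GL}(n+1)$ with $h\circ A=\overline{h}$ and $A(\overline{\mathcal{H}})=\mathcal{H}$. The moduli set of $n$-dimensional closed connected PSR manifolds is the set of equivalence classes.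 Let $\mathcal{H}\subset\{h=1\}$ be an $n$-dimensional closed connected PSR manifold, $n\geq 1$, and $U=\mathbb{R}_{>0}\cdot\mathcal{H}$ the cone it spans (an open convex cone). $\mathcal{H}$ has regular boundary behaviour if (i) $dh_p\neq0$ for all $p\in\partial U\setminus\{0\}$ (so $\partial U\setminus\{0\}$ is a smooth hypersurface), and (ii) for all $p\in\partial U\setminus\{0\}$ the restriction of $-\partial^2h_p$ to $T_p(\partial U\setminus\{0\})$ is positive semidefinite with kernel of dimension $1$. *)

theory Defs
  imports "HOL-Analysis.Analysis" "HOL-Library.Multiset"
begin

text \<open>
  A homogeneous cubic polynomial on a Euclidean space is given by its coefficients with respect to
  the cubic monomials in the linear coordinates belonging to \<^const>\<open>Basis\<close>.  A monomial is a
  multiset of three basis vectors.  The space of cubic polynomials is thereby the finite-dimensional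
  space of coefficient vectors with its usual topology.
\<close>

typedef (overloaded) ('a::euclidean_space) cubic_monomial = "multisets_of_size (Basis :: 'a set) 3"
proof -
  obtain b :: 'a where "b \<in> Basis"
    using nonempty_Basis by blast
  then have "replicate_mset 3 b \<in> multisets_of_size Basis 3"
    by (auto simp: multisets_of_size_def)
  then show ?thesis
    by blast
qed

instance cubic_monomial :: (euclidean_space) finite
proof
  interpret type_definition Rep_cubic_monomial Abs_cubic_monomial
      "multisets_of_size (Basis :: 'a set) 3"
    by (rule type_definition_cubic_monomial)
  have "finite (multisets_of_size (Basis :: 'a set) 3)"
    by (simp add: finite_multisets_of_size)
  then show "finite (UNIV :: 'a cubic_monomial set)"
    unfolding univ by (rule finite_imageI)
qed

type_synonym 'a cubic = "real ^ 'a cubic_monomial"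

definition cubic_eval :: "'a::euclidean_space cubic \<Rightarrow> 'a \<Rightarrow> real" where
  "cubic_eval h p = (\<Sum>m\<in>UNIV. h $ m * (\<Prod>b\<in>#Rep_cubic_monomial m. p \<bullet> b))"

definition hessian :: "('a::euclidean_space \<Rightarrow> real) \<Rightarrow> 'a \<Rightarrow> 'a \<Rightarrow> 'a \<Rightarrow> real" where
  "hessian f p u v = frechet_derivative (\<lambda>q. frechet_derivative f (at q) u) (at p) v"

text \<open>
  Signature of a nondegenerate symmetric bilinear form, in the sense of Sylvester: there is an
  orthogonal basis with \<open>r\<close> positive and \<open>s\<close> negative vectors.
\<close>

definition has_signature :: "('a::euclidean_space \<Rightarrow> 'a \<Rightarrow> real) \<Rightarrow> nat \<Rightarrow> nat \<Rightarrow> bool" where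
  "has_signature B r s \<longleftrightarrow>
     (\<exists>P N. finite P \<and> finite N \<and> P \<inter> N = {} \<and> card P = r \<and> card N = s \<and>
        independent (P \<union> N) \<and> span (P \<union> N) = UNIV \<and>
        (\<forall>u\<in>P \<union> N. \<forall>v\<in>P \<union> N. u \<noteq> v \<longrightarrow> B u v = 0) \<and>
        (\<forall>u\<in>P. B u u > 0) \<and> (\<forall>u\<in>N. B u u < 0))"

text \<open>
  The \<open>(n+1)\<close>-dimensional space with linear coordinates \<open>(x, y)\<close>, where \<open>n = CARD('n)\<close>.
\<close>

type_synonym 'n xy_space = "real \<times> (real ^ 'n)"

definition hyperbolic_point :: "'n::finite xy_space cubic \<Rightarrow> 'n xy_space \<Rightarrow> bool" where
  "hyperbolic_point h p \<longleftrightarrow>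
     cubic_eval h p > 0 \<and> has_signature (\<lambda>u v. - hessian (cubic_eval h) p u v) CARD('n) 1"

definition level_set :: "'n::finite xy_space cubic \<Rightarrow> 'n xy_space set" where
  "level_set h = {p. cubic_eval h p = 1}"

definition psr_manifold :: "'n::finite xy_space cubic \<Rightarrow> 'n xy_space set \<Rightarrow> bool" where
  "psr_manifold h H \<longleftrightarrow>
     H \<noteq> {} \<and> openin (top_of_set (level_set h)) H \<and> (\<forall>p\<in>H. hyperbolic_point h p)"

definition ccpsr_manifold :: "'n::finite xy_space cubic \<Rightarrow> 'n xy_space set \<Rightarrow> bool" where
  "ccpsr_manifold h H \<longleftrightarrow> psr_manifold h H \<and> connected H \<and> closed H"

definition psr_equivalent ::
  "'n::finite xy_space cubic \<Rightarrow> 'n xy_space set \<Rightarrow>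
   'n xy_space cubic \<Rightarrow> 'n xy_space set \<Rightarrow> bool" where
  "psr_equivalent h H h' H' \<longleftrightarrow>
     (\<exists>A. linear A \<and> bij A \<and> cubic_eval h \<circ> A = cubic_eval h' \<and> A ` H' = H)"

definition standard_form :: "'n::finite xy_space cubic \<Rightarrow> (real ^ 'n) cubic \<Rightarrow> bool" where
  "standard_form h P \<longleftrightarrow>
     (\<forall>x y. cubic_eval h (x, y) = x ^ 3 - x * (y \<bullet> y) + cubic_eval P y)"

definition standard_cubics :: "'n::finite xy_space cubic set" where
  "standard_cubics = {h. \<exists>P. standard_form h P}"

text \<open>
  The supremum is a maximum: the unit sphere is compact and nonempty and \<open>P\<close> is continuous.
\<close>

definition generating_cubics :: "'n::finite xy_space cubic set" where
  "generating_cubics =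
     {h. \<exists>P. standard_form h P \<and> (SUP y\<in>sphere 0 1. cubic_eval P y) \<le> 2 / (3 * sqrt 3)}"

definition base_component :: "'n::finite xy_space cubic \<Rightarrow> 'n xy_space set" where
  "base_component h = connected_component_set (level_set h) (1, 0)"

definition represents ::
  "'n::finite xy_space cubic \<Rightarrow> 'n xy_space cubic \<Rightarrow> 'n xy_space set \<Rightarrow> bool" where
  "represents h' h H \<longleftrightarrow>
     h' \<in> generating_cubics \<and> ccpsr_manifold h' (base_component h') \<and>
     psr_equivalent h H h' (base_component h')"

text \<open>
  Embedded topological submanifold of dimension \<open>d\<close>: locally flattened onto a \<open>d\<close>-dimensional
  linear subspace by homeomorphisms between open subsets of the ambient space.
\<close>

definition topological_submanifold :: "nat \<Rightarrow> 'v::euclidean_space set \<Rightarrow> bool" where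
  "topological_submanifold d S \<longleftrightarrow>
     (\<exists>L :: 'v set. subspace L \<and> dim L = d \<and>
        (\<forall>p\<in>S. \<exists>W W' f g. open W \<and> p \<in> W \<and> open W' \<and> homeomorphism W W' f g \<and>
           f ` (W \<inter> S) = W' \<inter> L))"

text \<open>
  Velocities at \<open>p\<close> of curves in \<open>S\<close> through \<open>p\<close>; this is the tangent space if \<open>S\<close> is a smooth
  hypersurface.
\<close>

definition tangent_space :: "'a::euclidean_space set \<Rightarrow> 'a \<Rightarrow> 'a set" where
  "tangent_space S p =
     {v. \<exists>\<gamma> :: real \<Rightarrow> 'a. \<gamma> 0 = p \<and> (\<forall>\<^sub>F t in at 0. \<gamma> t \<in> S) \<and> (\<gamma> has_vector_derivative v) (at 0)}"

definition spanned_cone :: "'a::real_vector set \<Rightarrow> 'a set" where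
  "spanned_cone H = {t *\<^sub>R p | t p. t > 0 \<and> p \<in> H}"

definition regular_boundary_behaviour ::
  "'n::finite xy_space cubic \<Rightarrow> 'n xy_space set \<Rightarrow> bool" where
  "regular_boundary_behaviour h H \<longleftrightarrow>
     (let S = frontier (spanned_cone H) - {0};
          B = (\<lambda>p u v. - hessian (cubic_eval h) p u v)
      in (\<forall>p\<in>S. frechet_derivative (cubic_eval h) (at p) \<noteq> (\<lambda>v. 0)) \<and>
         (\<forall>p\<in>S. (\<forall>u\<in>tangent_space S p. B p u u \<ge> 0) \<and>
            dim {u \<in> tangent_space S p. \<forall>v\<in>tangent_space S p. B p u v = 0} = 1))"

end

theory Submission
  imports Defs
begin

text \<open>
  Let \<open>T\<close> be the polar trilinear form of \<open>h\<close>.  At a hyperbolic point \<open>p\<close> of \<open>{h = 1}\<close> the form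
  \<open>T(p, _, _)\<close> is Lorentzian, and a basis adapted to it puts \<open>h\<close> into the form
  \<open>x^3 - x <y, y> + P(y)\<close>.  If \<open>P(e) > 2 / (3 sqrt 3)\<close> for a unit vector \<open>e\<close>, then \<open>h\<close> is positive
  on the whole ray \<open>(1, s e)\<close>, \<open>s \<ge> 0\<close>, but the Hessian restricted to the plane of \<open>(1, 0)\<close> and
  \<open>(0, e)\<close> has the wrong sign at \<open>s = 9 P(e) / 2\<close>.

  Conversely, if \<open>P \<le> 2 / (3 sqrt 3)\<close> on the unit sphere, then \<open>h \<le> 0\<close> on the boundary of the cone
  \<open>|y| < sqrt 3 x\<close>, which is the light cone of \<open>T((1, 0), _, _)\<close>.  Suppose that \<open>T(p, w, _) = 0\<close> for
  some \<open>w \<noteq> 0\<close> and some \<open>p\<close> in this cone with \<open>h(p) > 0\<close>.  Then \<open>w\<close> is spacelike, so the line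
  \<open>p + t w\<close> leaves the cone in both directions; but \<open>h(p + t w) = h(p) + t^3 h(w)\<close> stays positive in
  one of them.  Hence \<open>T(p, _, _)\<close> cannot degenerate and stays Lorentzian along the segment from the
  axis to \<open>p\<close>.  The same argument on \<open>{h = 0}\<close> gives regular boundary behaviour when the bound is
  strict, while in the case of equality \<open>dh\<close> vanishes at \<open>(1, sqrt 3 e)\<close>.

  As cubics are odd, the maximum over the sphere is a norm on the cubics; its unit ball, up to
  scaling, is the set of generating cubics.
\<close>

subsection \<open>Polarization of cubics\<close>

definition tri :: "'a::euclidean_space cubic \<Rightarrow> 'a \<Rightarrow> 'a \<Rightarrow> 'a \<Rightarrow> real" where
  "tri h u v w =
     (cubic_eval h (u + v + w) - cubic_eval h (u + v) - cubic_eval h (u + w) - cubic_eval h (v + w)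
       + cubic_eval h u + cubic_eval h v + cubic_eval h w) / 6"

definition perm3 :: "'a::euclidean_space \<Rightarrow> 'a \<Rightarrow> 'a \<Rightarrow> 'a \<Rightarrow> 'a \<Rightarrow> 'a \<Rightarrow> real" where
  "perm3 a b c u v w =
     ((u \<bullet> a) * (v \<bullet> b) * (w \<bullet> c) + (u \<bullet> a) * (v \<bullet> c) * (w \<bullet> b) + (u \<bullet> b) * (v \<bullet> a) * (w \<bullet> c) +
      (u \<bullet> b) * (v \<bullet> c) * (w \<bullet> a) + (u \<bullet> c) * (v \<bullet> a) * (w \<bullet> b) + (u \<bullet> c) * (v \<bullet> b) * (w \<bullet> a)) / 6"

lemma Rep_cubic_monomial_cases:
  fixes m :: "'a::euclidean_space cubic_monomial"
  obtains a b c where "a \<in> Basis" "b \<in> Basis" "c \<in> Basis" "Rep_cubic_monomial m = {#a, b, c#}"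
proof -
  have m: "set_mset (Rep_cubic_monomial m) \<subseteq> Basis" "size (Rep_cubic_monomial m) = 3"
    using Rep_cubic_monomial[of m] by (auto simp: multisets_of_size_def)
  then obtain a M where M: "Rep_cubic_monomial m = add_mset a M" "size M = 2"
    by (metis Suc_1 numeral_3_eq_3 nat.inject size_add_mset size_eq_Suc_imp_eq_union One_nat_def)
  then obtain b N where N: "M = add_mset b N" "size N = 1"
    by (metis Suc_1 nat.inject size_add_mset size_eq_Suc_imp_eq_union)
  then obtain c where "N = {#c#}"
    using size_1_singleton_mset by blast
  with M N have "Rep_cubic_monomial m = {#a, b, c#}" by simp
  with m that show ?thesis by auto
qed

lemma cubic_monomial_factors:
  obtains A B C :: "'a::euclidean_space cubic_monomial \<Rightarrow> 'a"
  where "\<And>m. A m \<in> Basis" "\<And>m. B m \<in> Basis" "\<And>m. C m \<in> Basis"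
    "\<And>m. Rep_cubic_monomial m = {#A m, B m, C m#}"
proof -
  have "\<forall>m :: 'a cubic_monomial. \<exists>t. fst t \<in> Basis \<and> fst (snd t) \<in> Basis \<and> snd (snd t) \<in> Basis \<and>
      Rep_cubic_monomial m = {#fst t, fst (snd t), snd (snd t)#}"
    by (metis Rep_cubic_monomial_cases fst_conv snd_conv)
  then obtain t :: "'a cubic_monomial \<Rightarrow> 'a \<times> 'a \<times> 'a" where
    "\<forall>m. fst (t m) \<in> Basis \<and> fst (snd (t m)) \<in> Basis \<and> snd (snd (t m)) \<in> Basis \<and>
      Rep_cubic_monomial m = {#fst (t m), fst (snd (t m)), snd (snd (t m))#}"
    by metis
  then show ?thesis
    by (intro that[of "\<lambda>m. fst (t m)" "\<lambda>m. fst (snd (t m))" "\<lambda>m. snd (snd (t m))"]) auto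
qed

lemma cubic_eval_expansion:
  assumes "\<And>m. Rep_cubic_monomial m = {#A m, B m, C m#}"
  shows "cubic_eval h p = (\<Sum>m\<in>UNIV. h $ m * ((p \<bullet> A m) * (p \<bullet> B m) * (p \<bullet> C m)))"
  by (simp add: cubic_eval_def assms mult.assoc)

lemma tri_expansion:
  assumes "\<And>m. Rep_cubic_monomial m = {#A m, B m, C m#}"
  shows "tri h u v w = (\<Sum>m\<in>UNIV. h $ m * perm3 (A m) (B m) (C m) u v w)"
  unfolding tri_def cubic_eval_expansion[OF assms]
  unfolding sum.distrib[symmetric] sum_subtractf[symmetric] sum_divide_distrib
  by (rule sum.cong) (auto simp: perm3_def inner_add_left field_simps)

lemma tri_commute12: "tri h u v w = tri h v u w"
  by (simp add: tri_def algebra_simps)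

lemma tri_commute23: "tri h u v w = tri h u w v"
  by (simp add: tri_def algebra_simps)

lemma tri_add_right: "tri h u v (w + w') = tri h u v w + tri h u v w'"
proof -
  obtain A B C :: "'a cubic_monomial \<Rightarrow> 'a" where ABC: "\<And>m. Rep_cubic_monomial m = {#A m, B m, C m#}"
    by (rule cubic_monomial_factors) blast
  show ?thesis
    unfolding tri_expansion[OF ABC] sum.distrib[symmetric]
    by (rule sum.cong) (auto simp: perm3_def inner_add_left field_simps)
qed

lemma tri_scale_right: "tri h u v (c *\<^sub>R w) = c * tri h u v w"
proof -
  obtain A B C :: "'a cubic_monomial \<Rightarrow> 'a" where ABC: "\<And>m. Rep_cubic_monomial m = {#A m, B m, C m#}"
    by (rule cubic_monomial_factors) blast
  show ?thesis
    unfolding tri_expansion[OF ABC] sum_distrib_left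
    by (rule sum.cong) (auto simp: perm3_def field_simps)
qed

lemma tri_add_middle: "tri h u (v + v') w = tri h u v w + tri h u v' w"
  using tri_add_right tri_commute23 by metis

lemma tri_scale_middle: "tri h u (c *\<^sub>R v) w = c * tri h u v w"
  using tri_scale_right tri_commute23 by metis

lemma tri_add_left: "tri h (u + u') v w = tri h u v w + tri h u' v w"
  using tri_add_middle tri_commute12 by metis

lemma tri_scale_left: "tri h (c *\<^sub>R u) v w = c * tri h u v w"
  using tri_scale_middle tri_commute12 by metis

lemma tri_zero [simp]: "tri h 0 v w = 0" "tri h u 0 w = 0" "tri h u v 0 = 0"
  using tri_scale_left[of h 0] tri_scale_middle[of h _ 0] tri_scale_right[of h _ _ 0] by simp_all

lemmas tri_linear =
  tri_add_left tri_add_middle tri_add_right tri_scale_left tri_scale_middle tri_scale_right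

lemma linear_tri: "linear (tri h u v)"
  by (intro linearI) (simp_all add: tri_linear)

lemma tri_diff_right: "tri h u v (w - w') = tri h u v w - tri h u v w'"
  by (rule linear_diff[OF linear_tri])

lemma tri_diff_middle: "tri h u (v - v') w = tri h u v w - tri h u v' w"
  using tri_diff_right tri_commute23 by metis

lemma tri_diag: "tri h p p p = cubic_eval h p"
proof -
  obtain A B C :: "'a cubic_monomial \<Rightarrow> 'a" where ABC: "\<And>m. Rep_cubic_monomial m = {#A m, B m, C m#}"
    by (rule cubic_monomial_factors) blast
  show ?thesis
    unfolding tri_expansion[OF ABC] cubic_eval_expansion[OF ABC]
    by (rule sum.cong) (auto simp: perm3_def field_simps)
qed

lemma cubic_eval_scale: "cubic_eval h (c *\<^sub>R p) = c ^ 3 * cubic_eval h p"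
  unfolding tri_diag[symmetric] by (simp add: tri_linear power3_eq_cube)

lemma cubic_eval_zero [simp]: "cubic_eval h 0 = 0"
  using cubic_eval_scale[of h 0] by simp

lemma cubic_eval_minus [simp]: "cubic_eval h (- p) = - cubic_eval h p"
  using cubic_eval_scale[of h "-1"] by simp

lemma cubic_eval_add_scale:
  "cubic_eval h (p + t *\<^sub>R v) =
     cubic_eval h p + 3 * t * tri h p p v + 3 * t\<^sup>2 * tri h p v v + t ^ 3 * cubic_eval h v"
  unfolding tri_diag[symmetric]
  by (simp add: tri_linear power3_eq_cube power2_eq_square algebra_simps
      tri_commute12[of h v p] tri_commute23[of h p v p] tri_commute23[of h v v p])

lemma cubic_eval_linear_coeff:
  "cubic_eval (g + h) p = cubic_eval g p + cubic_eval h p"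
  "cubic_eval (c *\<^sub>R h) p = c * cubic_eval h p"
  by (simp_all add: cubic_eval_def sum.distrib sum_distrib_left algebra_simps)

lemma continuous_on_tri [continuous_intros]:
  fixes f g k :: "'b::topological_space \<Rightarrow> 'a::euclidean_space"
  assumes "continuous_on S f" "continuous_on S g" "continuous_on S k"
  shows "continuous_on S (\<lambda>x. tri h (f x) (g x) (k x))"
proof -
  obtain A B C :: "'a cubic_monomial \<Rightarrow> 'a" where ABC: "\<And>m. Rep_cubic_monomial m = {#A m, B m, C m#}"
    by (rule cubic_monomial_factors) blast
  show ?thesis
    unfolding tri_expansion[OF ABC] perm3_def by (intro continuous_intros assms) auto
qed

lemma continuous_on_cubic_eval [continuous_intros]:
  fixes f :: "'b::topological_space \<Rightarrow> 'a::euclidean_space"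
  assumes "continuous_on S f"
  shows "continuous_on S (\<lambda>x. cubic_eval h (f x))"
  unfolding tri_diag[symmetric] by (intro continuous_intros assms)

lemma tri_has_derivative:
  "((\<lambda>q. tri h q q u) has_derivative (\<lambda>v. 2 * tri h p u v)) (at p)"
proof -
  obtain A B C :: "'a cubic_monomial \<Rightarrow> 'a" where ABC: "\<And>m. Rep_cubic_monomial m = {#A m, B m, C m#}"
    by (rule cubic_monomial_factors) blast
  have "((\<lambda>q. perm3 a b c q q u) has_derivative (\<lambda>v. 2 * perm3 a b c p u v)) (at p)" for a b c
    unfolding perm3_def
    by (auto intro!: derivative_eq_intros simp: fun_eq_iff field_simps)
  then have "((\<lambda>q. \<Sum>m\<in>UNIV. h $ m * perm3 (A m) (B m) (C m) q q u) has_derivative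
      (\<lambda>v. \<Sum>m\<in>UNIV. h $ m * (2 * perm3 (A m) (B m) (C m) p u v))) (at p)"
    by (intro has_derivative_sum has_derivative_mult_right)
  then show ?thesis
    unfolding tri_expansion[OF ABC] sum_distrib_left by (simp add: mult.left_commute)
qed

lemma cubic_eval_has_derivative:
  "(cubic_eval h has_derivative (\<lambda>v. 3 * tri h p p v)) (at p)"
proof -
  obtain A B C :: "'a cubic_monomial \<Rightarrow> 'a" where ABC: "\<And>m. Rep_cubic_monomial m = {#A m, B m, C m#}"
    by (rule cubic_monomial_factors) blast
  have "((\<lambda>q. perm3 a b c q q q) has_derivative (\<lambda>v. 3 * perm3 a b c p p v)) (at p)" for a b c
    unfolding perm3_def
    by (auto intro!: derivative_eq_intros simp: fun_eq_iff field_simps)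
  then have "((\<lambda>q. \<Sum>m\<in>UNIV. h $ m * perm3 (A m) (B m) (C m) q q q) has_derivative
      (\<lambda>v. \<Sum>m\<in>UNIV. h $ m * (3 * perm3 (A m) (B m) (C m) p p v))) (at p)"
    by (intro has_derivative_sum has_derivative_mult_right)
  moreover have "cubic_eval h = (\<lambda>q. tri h q q q)"
    by (simp add: tri_diag)
  ultimately show ?thesis
    unfolding tri_expansion[OF ABC] sum_distrib_left by (simp add: mult.left_commute)
qed

lemma frechet_derivative_cubic_eval:
  "frechet_derivative (cubic_eval h) (at p) = (\<lambda>v. 3 * tri h p p v)"
  using frechet_derivative_at[OF cubic_eval_has_derivative] by (rule sym)

lemma hessian_cubic_eval: "hessian (cubic_eval h) p u v = 6 * tri h p u v"
proof -
  have "((\<lambda>q. 3 * tri h q q u) has_derivative (\<lambda>v. 3 * (2 * tri h p u v))) (at p)"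
    by (intro has_derivative_mult_right tri_has_derivative)
  from frechet_derivative_at[OF this] show ?thesis
    unfolding hessian_def frechet_derivative_cubic_eval by (metis mult.assoc mult_2_right numeral_Bit0)
qed

lemma tri_axis:
  fixes h :: "'a::euclidean_space cubic"
  assumes m: "Rep_cubic_monomial m = {#a, b, c#}"
  shows "tri h a b c = h $ m * perm3 a b c a b c" and "perm3 a b c a b c \<noteq> 0"
proof -
  have abc: "a \<in> Basis" "b \<in> Basis" "c \<in> Basis"
    using Rep_cubic_monomial[of m] by (auto simp: multisets_of_size_def m)
  obtain A B C :: "'a cubic_monomial \<Rightarrow> 'a" where ABC: "\<And>m. A m \<in> Basis" "\<And>m. B m \<in> Basis"
    "\<And>m. C m \<in> Basis" "\<And>m. Rep_cubic_monomial m = {#A m, B m, C m#}"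
    by (rule cubic_monomial_factors) blast
  have 0: "perm3 (A m') (B m') (C m') a b c = 0" if "m' \<noteq> m" for m'
  proof (rule ccontr)
    assume "perm3 (A m') (B m') (C m') a b c \<noteq> 0"
    then have "{#A m', B m', C m'#} = {#a, b, c#}"
      using abc ABC(1-3)[of m']
      by (auto simp: perm3_def inner_Basis add_mset_commute split: if_splits)
    then have "Rep_cubic_monomial m' = Rep_cubic_monomial m"
      using m ABC(4)[of m'] by simp
    then show False using that by (simp add: Rep_cubic_monomial_inject)
  qed
  have *: "perm3 (A m) (B m) (C m) a b c = perm3 a b c a b c"
  proof -
    have "{#A m, B m, C m#} = {#a, b, c#}" using m ABC(4)[of m] by simp
    then have "(A m = a \<and> B m = b \<and> C m = c) \<or> (A m = a \<and> B m = c \<and> C m = b) \<or>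
      (A m = b \<and> B m = a \<and> C m = c) \<or> (A m = b \<and> B m = c \<and> C m = a) \<or>
      (A m = c \<and> B m = a \<and> C m = b) \<or> (A m = c \<and> B m = b \<and> C m = a)"
      by (auto simp: add_eq_conv_ex)
    then show ?thesis
      by (elim disjE conjE) (simp_all add: perm3_def algebra_simps)
  qed
  show "tri h a b c = h $ m * perm3 a b c a b c"
  proof -
    have "tri h a b c = (\<Sum>m'\<in>UNIV. if m' = m then h $ m * perm3 a b c a b c else 0)"
      unfolding tri_expansion[OF ABC(4)]
      by (rule sum.cong) (use 0 * in auto)
    then show ?thesis by simp
  qed
  show "perm3 a b c a b c \<noteq> 0"
    using abc by (auto simp: perm3_def inner_Basis)
qed

lemma cubic_eval_inject:
  fixes g h :: "'a::euclidean_space cubic"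
  shows "cubic_eval g = cubic_eval h \<longleftrightarrow> g = h"
proof
  assume eq: "cubic_eval g = cubic_eval h"
  show "g = h"
    unfolding vec_eq_iff
  proof
    fix m :: "'a cubic_monomial"
    obtain a b c where "Rep_cubic_monomial m = {#a, b, c#}"
      by (rule Rep_cubic_monomial_cases)
    from tri_axis[OF this] show "g $ m = h $ m"
      by (metis eq mult_right_cancel tri_def)
  qed
qed simp

lemma cubic_of_trilinear:
  fixes T :: "'a::euclidean_space \<Rightarrow> 'a \<Rightarrow> 'a \<Rightarrow> real"
  assumes lin: "\<And>u v. linear (\<lambda>w. T w u v)" "\<And>u v. linear (\<lambda>w. T u w v)" "\<And>u v. linear (T u v)"
  obtains h where "\<And>p. cubic_eval h p = T p p p"
proof -
  let ?B = "Basis :: 'a set"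
  let ?BBB = "?B \<times> ?B \<times> ?B"
  define ms :: "'a \<times> 'a \<times> 'a \<Rightarrow> 'a cubic_monomial" where
    "ms = (\<lambda>(a, b, c). Abs_cubic_monomial {#a, b, c#})"
  have Rep_ms: "Rep_cubic_monomial (ms (a, b, c)) = {#a, b, c#}" if "a \<in> ?B" "b \<in> ?B" "c \<in> ?B" for a b c
    unfolding ms_def using that
    by (auto intro!: Abs_cubic_monomial_inverse simp: multisets_of_size_def)
  define h :: "'a cubic" where
    "h = (\<chi> m. \<Sum>t | t \<in> ?BBB \<and> ms t = m. case t of (a, b, c) \<Rightarrow> T a b c)"
  have T: "T p p p = (\<Sum>(a, b, c)\<in>?BBB. T a b c * ((p \<bullet> a) * (p \<bullet> b) * (p \<bullet> c)))" for p
  proof -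
    have "T p p p = (\<Sum>a\<in>?B. (p \<bullet> a) * T a p p)"
      using linear_sum[OF lin(1)[of p p], of "\<lambda>a. (p \<bullet> a) *\<^sub>R a" ?B]
      by (simp add: euclidean_representation linear_cmul[OF lin(1)])
    also have "\<dots> = (\<Sum>a\<in>?B. (p \<bullet> a) * (\<Sum>b\<in>?B. (p \<bullet> b) * T a b p))"
      using linear_sum[OF lin(2)[of _ p], of _ "\<lambda>a. (p \<bullet> a) *\<^sub>R a" ?B]
      by (simp add: euclidean_representation linear_cmul[OF lin(2)])
    also have "\<dots> = (\<Sum>a\<in>?B. (p \<bullet> a) * (\<Sum>b\<in>?B. (p \<bullet> b) * (\<Sum>c\<in>?B. (p \<bullet> c) * T a b c)))"
      using linear_sum[OF lin(3), of _ _ "\<lambda>a. (p \<bullet> a) *\<^sub>R a" ?B]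
      by (simp add: euclidean_representation linear_cmul[OF lin(3)])
    also have "\<dots> = (\<Sum>a\<in>?B. \<Sum>b\<in>?B. \<Sum>c\<in>?B. T a b c * ((p \<bullet> a) * (p \<bullet> b) * (p \<bullet> c)))"
      by (simp add: sum_distrib_left mult_ac)
    finally show ?thesis
      by (simp add: sum.cartesian_product)
  qed
  have "cubic_eval h p = T p p p" for p
  proof -
    have "cubic_eval h p = (\<Sum>m\<in>UNIV. \<Sum>t | t \<in> ?BBB \<and> ms t = m.
        case t of (a, b, c) \<Rightarrow> T a b c * ((p \<bullet> a) * (p \<bullet> b) * (p \<bullet> c)))"
      unfolding cubic_eval_def h_def
      by (auto intro!: sum.cong simp: sum_distrib_right Rep_ms mult.assoc)
    also have "\<dots> = (\<Sum>t\<in>?BBB. case t of (a, b, c) \<Rightarrow> T a b c * ((p \<bullet> a) * (p \<bullet> b) * (p \<bullet> c)))"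
      by (rule sum.group) auto
    finally show ?thesis using T[of p] by simp
  qed
  with that show ?thesis by blast
qed

lemma cubic_eval_compose_linear:
  fixes h :: "'a::euclidean_space cubic" and f :: "'b::euclidean_space \<Rightarrow> 'a"
  assumes "linear f"
  obtains g where "\<And>p. cubic_eval g p = cubic_eval h (f p)"
proof -
  have "linear (\<lambda>w. tri h (f w) (f u) (f v))" "linear (\<lambda>w. tri h (f u) (f w) (f v))"
    "linear (\<lambda>w. tri h (f u) (f v) (f w))" for u v
    by (intro linearI; simp add: tri_linear linear_add[OF assms] linear_cmul[OF assms])+
  from cubic_of_trilinear[OF this] that show ?thesis
    by (metis tri_diag)
qed

lemma tri_compose_linear:
  assumes "linear f" "\<And>p. cubic_eval g p = cubic_eval h (f p)"
  shows "tri g u v w = tri h (f u) (f v) (f w)"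
  by (simp add: tri_def assms(2) linear_add[OF assms(1)])

lemma CARD_cubic_monomial:
  "CARD('a::euclidean_space cubic_monomial) = (DIM('a) + 2) choose 3"
proof -
  interpret type_definition Rep_cubic_monomial Abs_cubic_monomial
      "multisets_of_size (Basis :: 'a set) 3"
    by (rule type_definition_cubic_monomial)
  show ?thesis
    by (simp add: card card_multisets_of_size)
qed

subsection \<open>Lorentzian bilinear forms and hyperbolic points\<close>

lemma subspace_bilinear_orthogonal:
  "bilinear B \<Longrightarrow> subspace {v. B p v = 0}"
  by (auto simp: subspace_def bilinear_radd bilinear_rmul bilinear_rzero)

lemma orthogonal_basis_exists:
  fixes B :: "'a::euclidean_space \<Rightarrow> 'a \<Rightarrow> real"
  assumes B: "bilinear B" "\<And>u v. B u v = B v u"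
    and S: "subspace S" "\<And>v. v \<in> S \<Longrightarrow> v \<noteq> 0 \<Longrightarrow> B v v > 0"
  shows "\<exists>P. finite P \<and> independent P \<and> span P = S \<and> (\<forall>u\<in>P. \<forall>v\<in>P. u \<noteq> v \<longrightarrow> B u v = 0)"
  using S
proof (induction "dim S" arbitrary: S rule: less_induct)
  case less
  show ?case
  proof (cases "S = {0}")
    case True
    then show ?thesis using independent_empty by (intro exI[of _ "{}"]) simp
  next
    case False
    then obtain v where v: "v \<in> S" "v \<noteq> 0"
      using subspace_0[OF less.prems(1)] by auto
    then have pos: "B v v > 0" using less.prems by blast
    define S' where "S' = S \<inter> {u. B v u = 0}"
    have S': "subspace S'" unfolding S'_def
      by (intro subspace_inter less.prems subspace_bilinear_orthogonal B)
    have "v \<notin> S'" using pos by (auto simp: S'_def)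
    then have "S' \<subset> S" using v by (auto simp: S'_def)
    then have "span S' \<subset> span S"
      by (simp add: S' less.prems(1) span_eq_iff[THEN iffD2])
    then have "dim S' < dim S" by (rule dim_psubset)
    from less.hyps[OF this S'] less.prems obtain P where
      P: "finite P" "independent P" "span P = S'" "\<forall>u\<in>P. \<forall>v\<in>P. u \<noteq> v \<longrightarrow> B u v = 0"
      by (auto simp: S'_def)
    have PS: "P \<subseteq> S'" using P(3) span_superset by auto
    have "span (insert v P) = S"
    proof
      show "span (insert v P) \<subseteq> S"
        using v PS by (intro span_minimal less.prems) (auto simp: S'_def)
      show "S \<subseteq> span (insert v P)"
      proof
        fix u assume u: "u \<in> S"
        have "u - (B v u / B v v) *\<^sub>R v \<in> S'"
          using u v pos
          by (auto simp: S'_def bilinear_rsub[OF B(1)] bilinear_rmul[OF B(1)]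
              intro!: subspace_diff subspace_scale less.prems)
        then show "u \<in> span (insert v P)"
          using P(3) by (auto simp: span_breakdown_eq)
      qed
    qed
    moreover have "independent (insert v P)"
      using P \<open>v \<notin> S'\<close> by (simp add: independent_insertI)
    moreover have "\<forall>u\<in>insert v P. \<forall>w\<in>insert v P. u \<noteq> w \<longrightarrow> B u w = 0"
      using P(4) PS B(2) by (auto simp: S'_def)
    ultimately show ?thesis
      using P(1) by (intro exI[of _ "insert v P"]) auto
  qed
qed

lemma lorentz_adapted_basis:
  fixes B :: "'a::euclidean_space \<Rightarrow> 'a \<Rightarrow> real"
  assumes B: "bilinear B" "\<And>u v. B u v = B v u"
    and p: "B p p < 0" "\<And>v. B p v = 0 \<Longrightarrow> v \<noteq> 0 \<Longrightarrow> B v v > 0"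
  obtains P where "finite P" "card P = DIM('a) - 1" "p \<notin> P" "independent (insert p P)"
    "span (insert p P) = UNIV" "\<And>u. u \<in> P \<Longrightarrow> B p u = 0" "\<And>u. u \<in> P \<Longrightarrow> B u u > 0"
    "\<And>u v. u \<in> P \<Longrightarrow> v \<in> P \<Longrightarrow> u \<noteq> v \<Longrightarrow> B u v = 0"
proof -
  obtain P where P: "finite P" "independent P" "span P = {v. B p v = 0}"
      "\<forall>u\<in>P. \<forall>v\<in>P. u \<noteq> v \<longrightarrow> B u v = 0"
    using orthogonal_basis_exists[OF B subspace_bilinear_orthogonal[OF B(1), of p]] p(2) by auto
  have PS: "P \<subseteq> {v. B p v = 0}" using P(3) span_superset by auto
  have pP: "p \<notin> span P" using P(3) p(1) by auto
  then have ind: "independent (insert p P)"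
    using P by (simp add: independent_insertI)
  have "u \<in> span (insert p P)" for u
  proof -
    have "u - (B p u / B p p) *\<^sub>R p \<in> span P"
      using p(1) by (simp add: P(3) bilinear_rsub[OF B(1)] bilinear_rmul[OF B(1)])
    then show ?thesis by (auto simp: span_breakdown_eq)
  qed
  then have sp: "span (insert p P) = UNIV" by auto
  have pnP: "p \<notin> P" using pP span_base by blast
  have "card (insert p P) = DIM('a)"
    using dim_eq_card_independent[OF ind] dim_span[of "insert p P"] sp by simp
  then have card: "card P = DIM('a) - 1"
    using P(1) pnP by simp
  have pos: "B u u > 0" if "u \<in> P" for u
    using that PS p(2)[of u] P(2) dependent_zero[of P] by auto
  show ?thesis
    using P(1,4) card pnP ind sp PS pos by (intro that[of P]) auto
qed

lemma has_signature_lorentzI: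
  fixes B :: "'a::euclidean_space \<Rightarrow> 'a \<Rightarrow> real"
  assumes B: "bilinear B" "\<And>u v. B u v = B v u"
    and p: "B p p < 0" "\<And>v. B p v = 0 \<Longrightarrow> v \<noteq> 0 \<Longrightarrow> B v v > 0"
  shows "has_signature B (DIM('a) - 1) 1"
proof -
  obtain P where "finite P" "card P = DIM('a) - 1" "p \<notin> P" "independent (insert p P)"
    "span (insert p P) = UNIV" "\<And>u. u \<in> P \<Longrightarrow> B p u = 0" "\<And>u. u \<in> P \<Longrightarrow> B u u > 0"
    "\<And>u v. u \<in> P \<Longrightarrow> v \<in> P \<Longrightarrow> u \<noteq> v \<Longrightarrow> B u v = 0"
    using lorentz_adapted_basis[OF assms] by blast
  then show ?thesis
    unfolding has_signature_def
    by (intro exI[of _ P] exI[of _ "{p}"]) (use p(1) B(2) in auto)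
qed

lemma has_signature_lorentzD:
  fixes B :: "'a::euclidean_space \<Rightarrow> 'a \<Rightarrow> real"
  assumes B: "bilinear B" "\<And>u v. B u v = B v u" and sig: "has_signature B r 1"
    and p: "B p p < 0" and v: "B p v = 0" "v \<noteq> 0"
  shows "B v v > 0"
proof (rule ccontr)
  assume neg: "\<not> B v v > 0"
  from sig obtain P N where PN: "finite P" "card N = 1" "span (P \<union> N) = UNIV"
      "\<forall>u\<in>P \<union> N. \<forall>v\<in>P \<union> N. u \<noteq> v \<longrightarrow> B u v = 0" "\<forall>u\<in>P. B u u > 0"
    unfolding has_signature_def by blast
  then obtain u where u: "N = {u}" by (auto simp: card_1_singleton_iff)
  have pos: "B w w > 0" if w: "w \<in> span P" "w \<noteq> 0" for w
  proof -
    obtain c where c: "w = (\<Sum>i\<in>P. c i *\<^sub>R i)"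
      using w(1) unfolding span_finite[OF PN(1)] by auto
    have "B w w = (\<Sum>i\<in>P. \<Sum>j\<in>P. c j * (c i * B i j))"
      unfolding c using bilinear_sum[OF B(1), of "\<lambda>i. c i *\<^sub>R i" P "\<lambda>i. c i *\<^sub>R i" P]
      by (simp add: sum.cartesian_product bilinear_lmul[OF B(1)] bilinear_rmul[OF B(1)])
    also have "\<dots> = (\<Sum>i\<in>P. \<Sum>j\<in>P. if j = i then (c i)\<^sup>2 * B i i else 0)"
      using PN(4) by (intro sum.cong refl) (auto simp: power2_eq_square)
    also have "\<dots> = (\<Sum>i\<in>P. (c i)\<^sup>2 * B i i)"
      using PN(1) by simp
    also have "\<dots> > 0"
    proof -
      have "\<exists>i\<in>P. c i \<noteq> 0"
        using w(2) unfolding c by (rule contrapos_np) simp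
      then obtain i where i: "i \<in> P" "c i \<noteq> 0" by blast
      show ?thesis
      proof (rule sum_pos2[OF PN(1) i(1)])
        show "0 < (c i)\<^sup>2 * B i i" using i PN(5) by simp
        show "0 \<le> (c j)\<^sup>2 * B j j" if "j \<in> P" for j using that PN(5) by (simp add: less_imp_le)
      qed
    qed
    finally show ?thesis .
  qed
  obtain a where a: "p - a *\<^sub>R u \<in> span P"
    using PN(3) u span_breakdown_eq[of p u P] by auto
  obtain b where b: "v - b *\<^sub>R u \<in> span P"
    using PN(3) u span_breakdown_eq[of v u P] by auto
  have a0: "a \<noteq> 0"
    using a pos[of p] p bilinear_rzero[OF B(1)] by (cases "p = 0") auto
  define w where "w = v - (b / a) *\<^sub>R p"
  have "w = (v - b *\<^sub>R u) - (b / a) *\<^sub>R (p - a *\<^sub>R u)"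
    using a0 by (simp add: w_def algebra_simps)
  then have "w \<in> span P" using a b by (simp add: span_diff span_scale)
  moreover have Bw: "B w w = B v v + (b / a)\<^sup>2 * B p p"
    using v(1) B(2)[of v p]
    by (simp add: w_def bilinear_lsub[OF B(1)] bilinear_rsub[OF B(1)] bilinear_lmul[OF B(1)]
        bilinear_rmul[OF B(1)] power2_eq_square)
  ultimately have "w = 0"
    using pos[of w] neg p by (smt (verit) mult_nonneg_nonpos zero_le_power2)
  then have "v = (b / a) *\<^sub>R p" by (simp add: w_def)
  with v p show False
    by (auto simp: bilinear_rmul[OF B(1)])
qed

lemma bilinear_tri: "bilinear (\<lambda>u v. c * tri h p u v)"
  unfolding bilinear_def by (auto intro!: linearI simp: tri_linear algebra_simps)

lemma hyperbolic_pointI: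
  fixes h :: "'n::finite xy_space cubic"
  assumes "cubic_eval h p > 0" "tri h p q q > 0"
    and "\<And>v. tri h p q v = 0 \<Longrightarrow> v \<noteq> 0 \<Longrightarrow> tri h p v v < 0"
  shows "hyperbolic_point h p"
proof -
  have "has_signature (\<lambda>u v. - 6 * tri h p u v) (DIM('n xy_space) - 1) 1"
    using assms by (intro has_signature_lorentzI[where p = q] bilinear_tri) (auto simp: tri_commute23)
  then show ?thesis
    using assms by (simp add: hyperbolic_point_def hessian_cubic_eval)
qed

lemma hyperbolic_point_iff:
  fixes h :: "'n::finite xy_space cubic"
  shows "hyperbolic_point h p \<longleftrightarrow>
    cubic_eval h p > 0 \<and> (\<forall>v. tri h p p v = 0 \<longrightarrow> v \<noteq> 0 \<longrightarrow> tri h p v v < 0)"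
proof
  assume hyp: "hyperbolic_point h p"
  then have pos: "cubic_eval h p > 0"
    and sig: "has_signature (\<lambda>u v. - 6 * tri h p u v) CARD('n) 1"
    by (simp_all add: hyperbolic_point_def hessian_cubic_eval)
  have "tri h p v v < 0" if "tri h p p v = 0" "v \<noteq> 0" for v
    using has_signature_lorentzD[OF bilinear_tri _ sig, of p v] that pos
    by (simp add: tri_commute23 tri_diag)
  with pos show "cubic_eval h p > 0 \<and> (\<forall>v. tri h p p v = 0 \<longrightarrow> v \<noteq> 0 \<longrightarrow> tri h p v v < 0)"
    by blast
next
  assume "cubic_eval h p > 0 \<and> (\<forall>v. tri h p p v = 0 \<longrightarrow> v \<noteq> 0 \<longrightarrow> tri h p v v < 0)"
  then show "hyperbolic_point h p"
    by (intro hyperbolic_pointI[of h p p]) (auto simp: tri_diag)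
qed

subsection \<open>Invariance under linear equivalence\<close>

lemma linear_bij_inv:
  fixes A :: "'a::euclidean_space \<Rightarrow> 'a"
  assumes "linear A" "bij A"
  shows "linear (inv A)"
proof -
  obtain g where g: "linear g" "\<And>x. g (A x) = x"
    using linear_injective_left_inverse[OF assms(1)] bij_is_inj[OF assms(2)]
    by (metis comp_eq_dest_lhs id_apply)
  have "inv A = g"
    by (rule ext) (metis assms(2) bij_inv_eq_iff g(2))
  with g show ?thesis by simp
qed

lemma ccpsr_manifold_equivalent:
  assumes "psr_equivalent h H h' H'" "ccpsr_manifold h H"
  shows "ccpsr_manifold h' H'"
proof -
  obtain A where A: "linear A" "bij A" "cubic_eval h \<circ> A = cubic_eval h'" "A ` H' = H"
    using assms(1) unfolding psr_equivalent_def by blast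
  have ev: "cubic_eval h' p = cubic_eval h (A p)" for p
    using A(3) by (metis comp_apply)
  have tri: "tri h' u v w = tri h (A u) (A v) (A w)" for u v w
    by (rule tri_compose_linear[OF A(1) ev])
  have cont: "continuous_on UNIV A" "continuous_on H (inv A)"
    by (auto intro!: linear_continuous_on linear_bij_inv A simp: linear_conv_bounded_linear[symmetric])
  have H': "H' = A -` H" "H' = inv A ` H"
    unfolding A(4)[symmetric]
    by (simp_all add: inj_vimage_image_eq image_inv_f_f bij_is_inj[OF A(2)])
  have A0: "A v = 0 \<longleftrightarrow> v = 0" for v
    using A(1,2) by (metis bij_is_inj inj_eq linear_0)
  note cc = assms(2)[unfolded ccpsr_manifold_def psr_manifold_def]
  obtain T where T: "open T" "H = level_set h \<inter> T"
    using cc unfolding openin_open by blast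
  have "open (A -` T)"
    using T(1) cont(1) by (simp add: continuous_on_open_vimage)
  moreover have "H' = level_set h' \<inter> A -` T"
    unfolding H'(1) T(2) by (auto simp: level_set_def ev)
  ultimately have "openin (top_of_set (level_set h')) H'"
    by (auto simp: openin_open)
  moreover have "H' \<noteq> {}" using cc A(4) by auto
  moreover have "hyperbolic_point h' p" if "p \<in> H'" for p
  proof -
    have "hyperbolic_point h (A p)" using cc that A(4) by auto
    then show ?thesis
      unfolding hyperbolic_point_iff ev tri by (metis A0)
  qed
  moreover have "connected H'"
    unfolding H'(2) using cc cont(2) by (intro connected_continuous_image) auto
  moreover have "closed H'"
    unfolding H'(1) using cc cont(1) by (intro continuous_closed_vimage) (auto simp: continuous_on_eq_continuous_at)
  ultimately show ?thesis
    by (simp add: ccpsr_manifold_def psr_manifold_def)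
qed

lemma regular_boundary_behaviour_iff:
  "regular_boundary_behaviour h H \<longleftrightarrow>
    (\<forall>p\<in>frontier (spanned_cone H) - {0}.
      (\<exists>v. tri h p p v \<noteq> 0) \<and>
      (\<forall>u\<in>tangent_space (frontier (spanned_cone H) - {0}) p. tri h p u u \<le> 0) \<and>
      dim {u \<in> tangent_space (frontier (spanned_cone H) - {0}) p.
            \<forall>v\<in>tangent_space (frontier (spanned_cone H) - {0}) p. tri h p u v = 0} = 1)"
  unfolding regular_boundary_behaviour_def Let_def hessian_cubic_eval frechet_derivative_cubic_eval
  by (auto simp: fun_eq_iff)

lemma tangent_space_linear_image:
  assumes "linear A" "v \<in> tangent_space S p"
  shows "A v \<in> tangent_space (A ` S) (A p)"
proof -
  obtain \<gamma> :: "real \<Rightarrow> 'a" where g: "\<gamma> 0 = p" "\<forall>\<^sub>F t in at 0. \<gamma> t \<in> S" "(\<gamma> has_vector_derivative v) (at 0)"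
    using assms(2) by (auto simp: tangent_space_def)
  have "((\<lambda>t. A (\<gamma> t)) has_vector_derivative A v) (at 0)"
    using assms(1) g(3) by (simp add: linear_conv_bounded_linear bounded_linear.has_vector_derivative)
  moreover have "\<forall>\<^sub>F t in at 0. A (\<gamma> t) \<in> A ` S"
    using g(2) by (rule eventually_mono) auto
  ultimately show ?thesis
    using g(1) by (auto simp: tangent_space_def intro!: exI[of _ "\<lambda>t. A (\<gamma> t)"])
qed

lemma tangent_space_bij_image:
  fixes A :: "'a::euclidean_space \<Rightarrow> 'a"
  assumes "linear A" "bij A"
  shows "tangent_space (A ` S) (A p) = A ` tangent_space S p"
proof
  show "A ` tangent_space S p \<subseteq> tangent_space (A ` S) (A p)"
    using tangent_space_linear_image[OF assms(1)] by blast
  show "tangent_space (A ` S) (A p) \<subseteq> A ` tangent_space S p"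
  proof
    fix v assume "v \<in> tangent_space (A ` S) (A p)"
    from tangent_space_linear_image[OF linear_bij_inv[OF assms] this]
    have "inv A v \<in> tangent_space S p"
      using assms(2) by (simp add: bij_is_inj image_inv_f_f)
    then show "v \<in> A ` tangent_space S p"
      using assms(2) by (metis bij_inv_eq_iff image_eqI)
  qed
qed

lemma spanned_cone_linear_image: "linear A \<Longrightarrow> spanned_cone (A ` H) = A ` spanned_cone H"
  unfolding spanned_cone_def by (auto simp: linear_cmul image_iff) (metis linear_cmul)+

lemma frontier_bij_linear_image:
  fixes A :: "'a::euclidean_space \<Rightarrow> 'a"
  assumes "linear A" "bij A"
  shows "frontier (A ` S) = A ` frontier S"
  using assms by (simp add: frontier_def closure_injective_linear_image bij_is_inj
      interior_injective_linear_image image_set_diff)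

lemma regular_boundary_behaviour_equivalent:
  assumes "psr_equivalent h H h' H'"
  shows "regular_boundary_behaviour h H \<longleftrightarrow> regular_boundary_behaviour h' H'"
proof -
  obtain A where A: "linear A" "bij A" "cubic_eval h \<circ> A = cubic_eval h'" "A ` H' = H"
    using assms unfolding psr_equivalent_def by blast
  have ev: "cubic_eval h' p = cubic_eval h (A p)" for p
    using A(3) by (metis comp_apply)
  have tri: "tri h' u v w = tri h (A u) (A v) (A w)" for u v w
    by (rule tri_compose_linear[OF A(1) ev])
  define S where "S = frontier (spanned_cone H) - {0}"
  define S' where "S' = frontier (spanned_cone H') - {0}"
  have S: "S = A ` S'"
    unfolding S_def S'_def A(4)[symmetric] spanned_cone_linear_image[OF A(1)]
      frontier_bij_linear_image[OF A(1,2)] image_set_diff[OF bij_is_inj[OF A(2)]]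
    by (simp add: linear_0[OF A(1)])
  have ex: "(\<exists>v. P v) \<longleftrightarrow> (\<exists>v. P (A v))" for P
    using A(2) by (metis bij_pointE)
  have T: "tangent_space S (A p) = A ` tangent_space S' p" for p
    unfolding S by (rule tangent_space_bij_image[OF A(1,2)])
  have "{u \<in> A ` tangent_space S' p. \<forall>v\<in>tangent_space S' p. tri h (A p) u (A v) = 0} =
     A ` {u \<in> tangent_space S' p. \<forall>v\<in>tangent_space S' p. tri h' p u v = 0}" for p
    by (auto simp: tri)
  then have dim: "dim {u \<in> A ` tangent_space S' p. \<forall>v\<in>tangent_space S' p. tri h (A p) u (A v) = 0} =
     dim {u \<in> tangent_space S' p. \<forall>v\<in>tangent_space S' p. tri h' p u v = 0}" for p
    using A(1,2) by (simp add: dim_image_eq bij_is_inj inj_on_subset[OF bij_is_inj])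
  show ?thesis
    unfolding regular_boundary_behaviour_iff S_def[symmetric] S'_def[symmetric]
    unfolding S ball_simps unfolding S[symmetric] T ball_simps dim
    by (subst ex) (simp add: tri)
qed

subsection \<open>Hyperbolicity of cubics in standard form\<close>

lemma standard_form_tri:
  assumes "standard_form h P"
  shows "tri h (x, y) (a, w) (b, v) =
    x * a * b - (x * (w \<bullet> v) + a * (y \<bullet> v) + b * (y \<bullet> w)) / 3 + tri P y w v"
proof -
  have h: "cubic_eval h (x, y) = x ^ 3 - x * (y \<bullet> y) + cubic_eval P y" for x y
    using assms by (simp add: standard_form_def)
  show ?thesis
    unfolding tri_def add_Pair h
    by (simp add: inner_add_left inner_add_right inner_commute field_simps power3_eq_cube)
qed

lemma timelike_kernel_trivial:
  fixes h :: "'n::finite xy_space cubic"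
  assumes sf: "standard_form h P" and p: "x > 0" "y \<bullet> y < 3 * x\<^sup>2"
    and ker: "\<And>v. tri h (x, y) w v = 0"
    and bd: "\<And>x' y'. x' > 0 \<Longrightarrow> y' \<bullet> y' = 3 * x'\<^sup>2 \<Longrightarrow> cubic_eval h (x', y') < cubic_eval h (x, y)"
  shows "w = 0"
proof (rule ccontr)
  assume w0: "w \<noteq> 0"
  obtain a b where w: "w = (a, b)" by fastforce
  have ab: "3 * x * a = y \<bullet> b"
    using ker[of "(1, 0)"] unfolding w standard_form_tri[OF sf] by simp
  have b0: "b \<noteq> 0"
    using w0 ab p(1) by (auto simp: w zero_prod_def)
  define N where "N = b \<bullet> b / 3 - a\<^sup>2"
  define M where "M = x\<^sup>2 - y \<bullet> y / 3"
  have M: "M > 0" using p by (simp add: M_def)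
  have N: "N > 0"
  proof -
    have "9 * x\<^sup>2 * a\<^sup>2 = (y \<bullet> b)\<^sup>2"
      by (simp add: ab[symmetric] power2_eq_square)
    also have "\<dots> \<le> (y \<bullet> y) * (b \<bullet> b)"
      by (rule Cauchy_Schwarz_ineq)
    also have "\<dots> < 3 * x\<^sup>2 * (b \<bullet> b)"
      using p b0 by (intro mult_strict_right_mono) auto
    finally have "x\<^sup>2 * (9 * a\<^sup>2) < x\<^sup>2 * (3 * (b \<bullet> b))" by (simp add: mult_ac)
    then show ?thesis using p(1) by (simp add: N_def)
  qed
  define t where "t = (if cubic_eval h w \<ge> 0 then sqrt (M / N) else - sqrt (M / N))"
  have t2: "t\<^sup>2 = M / N" using M N by (simp add: t_def)
  have t3: "t ^ 3 * cubic_eval h w \<ge> 0"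
    using M N by (auto simp: t_def power3_eq_cube mult_nonneg_nonpos mult_nonpos_nonpos zero_le_mult_iff mult_le_0_iff)
  define x' y' where "x' = x + t * a" and "y' = y + t *\<^sub>R b"
  have q: "(x', y') = (x, y) + t *\<^sub>R w" by (simp add: x'_def y'_def w)
  have hq: "cubic_eval h (x', y') \<ge> cubic_eval h (x, y)"
    unfolding q cubic_eval_add_scale tri_commute23[of h "(x, y)" "(x, y)" w] using ker t3 by simp
  have null: "y' \<bullet> y' = 3 * x'\<^sup>2"
  proof -
    have "x'\<^sup>2 - y' \<bullet> y' / 3 = M + 2 * t * (3 * x * a - y \<bullet> b) / 3 - t\<^sup>2 * N"
      unfolding x'_def y'_def M_def N_def
      by (simp add: inner_add_left inner_add_right inner_commute power2_eq_square field_simps)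
    also have "\<dots> = 0" using ab t2 N by simp
    finally show ?thesis by simp
  qed
  have xx: "x * x' - y \<bullet> y' / 3 > 0"
  proof -
    have "x * x' - y \<bullet> y' / 3 = M + t * (3 * x * a - y \<bullet> b) / 3"
      unfolding x'_def y'_def M_def
      by (simp add: inner_add_right power2_eq_square field_simps)
    then show ?thesis using ab M by simp
  qed
  have "x' > 0"
  proof (rule ccontr)
    assume neg: "\<not> x' > 0"
    have "(y \<bullet> y')\<^sup>2 \<le> (y \<bullet> y) * (y' \<bullet> y')"
      by (rule Cauchy_Schwarz_ineq)
    also have "\<dots> \<le> 3 * x\<^sup>2 * (y' \<bullet> y')"
      using p by (intro mult_right_mono) auto
    also have "\<dots> = (3 * x * x')\<^sup>2" by (simp add: null power2_eq_square)
    finally have "\<bar>y \<bullet> y'\<bar> \<le> \<bar>3 * x * x'\<bar>" by (simp add: abs_le_square_iff)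
    also have "\<dots> = - (3 * x * x')" using neg p(1) by (simp add: abs_mult)
    finally show False using xx by linarith
  qed
  with bd[OF this null] hq show False by simp
qed

lemma psd_zero_imp_kernel:
  fixes b c :: real
  assumes "\<And>s. 2 * s * b + s\<^sup>2 * c \<ge> 0"
  shows "b = 0"
proof (rule ccontr)
  assume b: "b \<noteq> 0"
  define d where "d = \<bar>c\<bar> + 1"
  have d: "d > 0" "c < d" by (auto simp: d_def)
  have "2 * (- b / d) * b + (- b / d)\<^sup>2 * c = (b\<^sup>2 / d) * (c / d - 2)"
    using d by (simp add: power2_eq_square field_simps)
  also have "\<dots> < 0"
    using b d by (intro mult_pos_neg) (auto simp: field_simps)
  finally show False using assms[of "- b / d"] by simp
qed

abbreviation "kappa \<equiv> 2 / (3 * sqrt 3) :: real"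

lemma
  fixes h :: "'n::finite xy_space cubic"
  assumes sf: "standard_form h P" and P: "\<And>y. cubic_eval P y \<le> kappa * norm y ^ 3"
  shows standard_form_null_nonpos:
      "\<And>x y. x > 0 \<Longrightarrow> y \<bullet> y = 3 * x\<^sup>2 \<Longrightarrow> cubic_eval h (x, y) \<le> 0"
    and standard_form_segment:
      "\<And>x y \<tau>. x > 0 \<Longrightarrow> y \<bullet> y < 3 * x\<^sup>2 \<Longrightarrow> 0 \<le> \<tau> \<Longrightarrow> \<tau> \<le> 1 \<Longrightarrow>
        cubic_eval h (x, y) \<le> cubic_eval h (x, \<tau> *\<^sub>R y)"
proof -
  have c: "3 * cubic_eval P y \<le> 2 * x * (y \<bullet> y)" if "x > 0" "y \<bullet> y \<le> 3 * x\<^sup>2" for x y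
  proof -
    have "norm y \<le> sqrt 3 * x"
      using that by (auto simp: norm_eq_sqrt_inner real_sqrt_mult intro!: real_le_lsqrt simp: power_mult_distrib)
    have "3 * cubic_eval P y \<le> 3 * (kappa * norm y ^ 3)"
      by (intro mult_left_mono P) simp
    also have "\<dots> = 2 / sqrt 3 * (norm y)\<^sup>2 * norm y"
      by (simp add: power2_eq_square power3_eq_cube)
    also have "\<dots> \<le> 2 / sqrt 3 * (norm y)\<^sup>2 * (sqrt 3 * x)"
      by (intro mult_left_mono \<open>norm y \<le> sqrt 3 * x\<close>) auto
    also have "\<dots> = 2 * x * (y \<bullet> y)" by (simp add: power2_norm_eq_inner)
    finally show ?thesis .
  qed
  have h: "cubic_eval h (x, y) = x ^ 3 - x * (y \<bullet> y) + cubic_eval P y" for x y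
    using sf by (simp add: standard_form_def)
  show "cubic_eval h (x, y) \<le> 0" if "x > 0" "y \<bullet> y = 3 * x\<^sup>2" for x y
    using c[of x y] that by (simp add: h power2_eq_square power3_eq_cube)
  show "cubic_eval h (x, y) \<le> cubic_eval h (x, \<tau> *\<^sub>R y)"
    if "x > 0" "y \<bullet> y < 3 * x\<^sup>2" "0 \<le> \<tau>" "\<tau> \<le> 1" for x y \<tau>
  proof -
    have "3 * (cubic_eval h (x, \<tau> *\<^sub>R y) - cubic_eval h (x, y)) =
        x * (y \<bullet> y) * ((1 - \<tau>)\<^sup>2 * (1 + 2 * \<tau>)) + (2 * x * (y \<bullet> y) - 3 * cubic_eval P y) * (1 - \<tau> ^ 3)"
      by (simp add: h cubic_eval_scale power2_eq_square power3_eq_cube algebra_simps)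
    also have "\<dots> \<ge> 0"
      using c[of x y] that by (intro add_nonneg_nonneg mult_nonneg_nonneg) (auto simp: power_le_one)
    finally show ?thesis by simp
  qed
qed

proposition standard_form_hyperbolic:
  fixes h :: "'n::finite xy_space cubic"
  assumes sf: "standard_form h P" and P: "\<And>y. cubic_eval P y \<le> kappa * norm y ^ 3"
    and p: "x > 0" "y \<bullet> y < 3 * x\<^sup>2" "cubic_eval h (x, y) > 0"
  shows "hyperbolic_point h (x, y)"
proof -
  define Q where "Q = (\<lambda>\<tau> w. x * (w \<bullet> w) / 3 + \<tau>\<^sup>2 * (y \<bullet> w)\<^sup>2 / (9 * x) - \<tau> * tri P y w w)"
  have T: "tri h (x, \<tau> *\<^sub>R y) (a, w) (a, w) = x * (a - \<tau> * (y \<bullet> w) / (3 * x))\<^sup>2 - Q \<tau> w" for \<tau> a w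
    using p(1) unfolding standard_form_tri[OF sf] Q_def
    by (simp add: tri_scale_left power2_eq_square field_simps)
  have Qscale: "Q \<tau> (c *\<^sub>R w) = c\<^sup>2 * Q \<tau> w" for \<tau> c w
    by (simp add: Q_def tri_linear power2_eq_square field_simps)
  have contQ: "continuous_on UNIV (\<lambda>q. Q (fst q) (snd q))"
    unfolding Q_def using p(1) by (intro continuous_intros) auto
  have Qunit: "Q \<tau> w > 0" if "0 \<le> \<tau>" "\<tau> \<le> 1" "norm w = 1" for \<tau> w
  proof (rule ccontr)
    assume bad: "\<not> Q \<tau> w > 0"
    define K where "K = ({0..1} \<times> sphere 0 1) \<inter> {q. Q (fst q) (snd q) \<le> 0}"
    have "compact K" unfolding K_def
      by (intro compact_Int_closed compact_Times compact_sphere closed_Collect_le contQ continuous_intros) auto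
    moreover have "(\<tau>, w) \<in> K" using bad that by (simp add: K_def)
    then have "K \<noteq> {}" by blast
    ultimately obtain q0 where q0: "q0 \<in> K" "\<And>q. q \<in> K \<Longrightarrow> fst q0 \<le> fst q"
      using continuous_attains_inf[of K fst] continuous_on_fst[OF continuous_on_id] by (metis id_apply)
    obtain t w where tw: "q0 = (t, w)" by fastforce
    have t: "0 \<le> t" "t \<le> 1" "norm w = 1" "Q t w \<le> 0"
      using q0(1) by (auto simp: tw K_def)
    have min: "Q s v > 0" if "0 \<le> s" "s < t" "norm v = 1" for s v
      using q0(2)[of "(s, v)"] that t by (force simp: tw K_def)
    have "t \<noteq> 0"
    proof
      assume "t = 0"
      then have "Q t w = x / 3" using t(3) by (simp add: Q_def flip: power2_norm_eq_inner)
      with t p show False by simp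
    qed
    have psd1: "Q t v \<ge> 0" if "norm v = 1" for v
    proof (rule tendsto_lowerbound)
      have "isCont (\<lambda>s. Q s v) t" unfolding Q_def using p(1) by (intro continuous_intros) auto
      then show "((\<lambda>s. Q s v) \<longlongrightarrow> Q t v) (at_left t)"
        by (auto simp: isCont_def intro: tendsto_mono at_le)
      show "\<forall>\<^sub>F s in at_left t. 0 \<le> Q s v"
        unfolding eventually_at_left_field using min that \<open>t \<noteq> 0\<close> t(1)
        by (intro exI[of _ 0]) (auto intro: less_imp_le)
    qed auto
    have psd: "Q t v \<ge> 0" for v
    proof (cases "v = 0")
      case False
      then have "Q t v = (norm v)\<^sup>2 * Q t (inverse (norm v) *\<^sub>R v)"
        by (simp add: Qscale field_simps)
      also have "\<dots> \<ge> 0" using False by (intro mult_nonneg_nonneg psd1) auto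
      finally show ?thesis .
    qed (simp add: Q_def)
    have Qtw: "Q t w = 0" using psd[of w] t(4) by simp
    have ker: "x * (w \<bullet> v) / 3 + t\<^sup>2 * (y \<bullet> w) * (y \<bullet> v) / (9 * x) - t * tri P y w v = 0" for v
    proof (rule psd_zero_imp_kernel)
      fix s
      have "Q t (w + s *\<^sub>R v) = Q t w +
          2 * s * (x * (w \<bullet> v) / 3 + t\<^sup>2 * (y \<bullet> w) * (y \<bullet> v) / (9 * x) - t * tri P y w v) + s\<^sup>2 * Q t v"
        using p(1) unfolding Q_def
        by (simp add: tri_linear tri_commute23[of P y v w] inner_add_left inner_add_right inner_commute[of v w]
            power2_eq_square field_simps)
      then show "0 \<le> 2 * s * (x * (w \<bullet> v) / 3 + t\<^sup>2 * (y \<bullet> w) * (y \<bullet> v) / (9 * x) - t * tri P y w v) + s\<^sup>2 * Q t v"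
        using psd[of "w + s *\<^sub>R v"] Qtw by simp
    qed
    have "(t * (y \<bullet> w) / (3 * x), w) = 0"
    proof (rule timelike_kernel_trivial[OF sf p(1)])
      have t2: "t\<^sup>2 \<le> 1" using t by (simp add: power_le_one)
      have "(t *\<^sub>R y) \<bullet> (t *\<^sub>R y) = t\<^sup>2 * (y \<bullet> y)" by (simp add: power2_eq_square)
      also have "\<dots> \<le> y \<bullet> y" using t2 by (simp add: mult_left_le_one_le)
      finally show "(t *\<^sub>R y) \<bullet> (t *\<^sub>R y) < 3 * x\<^sup>2" using p(2) by simp
      show "tri h (x, t *\<^sub>R y) (t * (y \<bullet> w) / (3 * x), w) v = 0" for v
      proof -
        obtain a u where v: "v = (a, u)" by fastforce
        have "tri h (x, t *\<^sub>R y) (t * (y \<bullet> w) / (3 * x), w) (a, u) =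
          - (x * (w \<bullet> u) / 3 + t\<^sup>2 * (y \<bullet> w) * (y \<bullet> u) / (9 * x) - t * tri P y w u)"
          using p(1) unfolding standard_form_tri[OF sf]
          by (simp add: tri_scale_left power2_eq_square field_simps)
        then show ?thesis using ker[of u] by (simp add: v)
      qed
      show "cubic_eval h (x', y') < cubic_eval h (x, t *\<^sub>R y)" if "x' > 0" "y' \<bullet> y' = 3 * x'\<^sup>2" for x' y'
        using standard_form_null_nonpos[OF sf P that] standard_form_segment[OF sf P p(1,2) t(1,2)] p(3)
        by linarith
    qed
    then show False using t(3) by (auto simp: zero_prod_def)
  qed
  have Qpos: "Q 1 w > 0" if "w \<noteq> 0" for w
  proof -
    have "Q 1 w = (norm w)\<^sup>2 * Q 1 (inverse (norm w) *\<^sub>R w)"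
      using that by (simp add: Qscale field_simps)
    also have "\<dots> > 0" using that by (intro mult_pos_pos Qunit) auto
    finally show ?thesis .
  qed
  show ?thesis
  proof (rule hyperbolic_pointI[OF p(3)])
    show "0 < tri h (x, y) (1, 0) (1, 0)"
      using p(1) by (simp add: standard_form_tri[OF sf])
    fix v assume v: "tri h (x, y) (1, 0) v = 0" "v \<noteq> 0"
    obtain a w where v': "v = (a, w)" by fastforce
    have a: "a = y \<bullet> w / (3 * x)"
      using v(1) p(1) unfolding v' standard_form_tri[OF sf] by (simp add: field_simps)
    then have "w \<noteq> 0" using v(2) by (auto simp: v' zero_prod_def)
    then show "tri h (x, y) v v < 0"
      using T[of 1 a w] Qpos[of w] a by (simp add: v')
  qed
qed

subsection \<open>The base component and reduction to standard form\<close>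

lemma base_component_eq:
  fixes h :: "'n::finite xy_space cubic"
  assumes sf: "standard_form h P" and P: "\<And>y. cubic_eval P y \<le> kappa * norm y ^ 3"
  shows "base_component h =
      {p. cubic_eval h p = 1 \<and> fst p > 0 \<and> snd p \<bullet> snd p < 3 * (fst p)\<^sup>2}" (is "_ = ?B")
    and "base_component h =
      {p. cubic_eval h p = 1 \<and> fst p \<ge> 0 \<and> snd p \<bullet> snd p \<le> 3 * (fst p)\<^sup>2}" (is "_ = ?B'")
proof -
  have h: "cubic_eval h (x, y) = x ^ 3 - x * (y \<bullet> y) + cubic_eval P y" for x y
    using sf by (simp add: standard_form_def)
  have eq: "?B = ?B'"
  proof -
    have "x > 0 \<and> y \<bullet> y < 3 * x\<^sup>2"
      if "cubic_eval h (x, y) = 1" "x \<ge> 0" "y \<bullet> y \<le> 3 * x\<^sup>2" for x y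
    proof -
      have "x \<noteq> 0"
      proof
        assume x: "x = 0"
        then have "y = 0" using that(3) by (metis inner_eq_zero_iff inner_ge_zero mult_zero_right order_antisym zero_power2)
        with x that(1) show False by (simp add: h)
      qed
      with that have "x > 0" by simp
      then show ?thesis
        using standard_form_null_nonpos[OF sf P, of x y] that by force
    qed
    then show ?thesis by auto
  qed
  define C where "C = base_component h"
  have base: "(1, 0) \<in> level_set h" by (simp add: level_set_def h)
  have "?B \<subseteq> C"
  proof
    fix p assume "p \<in> ?B"
    then obtain x y where p: "p = (x, y)" "cubic_eval h (x, y) = 1" "x > 0" "y \<bullet> y < 3 * x\<^sup>2"
      by (cases p) auto
    define \<gamma> where "\<gamma> = (\<lambda>\<tau>. inverse (root 3 (cubic_eval h (x, \<tau> *\<^sub>R y))) *\<^sub>R (x, \<tau> *\<^sub>R y))"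
    have pos: "cubic_eval h (x, \<tau> *\<^sub>R y) > 0" if "\<tau> \<in> {0..1}" for \<tau>
      using standard_form_segment[OF sf P p(3,4), of \<tau>] that p(2) by auto
    have "continuous_on {0..1} \<gamma>"
      unfolding \<gamma>_def by (intro continuous_intros) (use pos in force)
    then have "connected (\<gamma> ` {0..1})" by (intro connected_continuous_image) auto
    moreover have "\<gamma> ` {0..1} \<subseteq> level_set h"
    proof -
      have "cubic_eval h (\<gamma> \<tau>) = 1" if "\<tau> \<in> {0..1}" for \<tau>
        using pos[OF that] unfolding \<gamma>_def cubic_eval_scale
        by (simp add: power_inverse odd_real_root_pow)
      then show ?thesis by (auto simp: level_set_def)
    qed
    moreover have "(1, 0) \<in> \<gamma> ` {0..1}"
    proof
      have "cubic_eval h (x, 0) = x ^ 3" by (simp add: h)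
      then show "(1, 0) = \<gamma> 0" using p(3)
        by (simp add: \<gamma>_def odd_real_root_power_cancel)
    qed simp
    ultimately have "\<gamma> ` {0..1} \<subseteq> C"
      unfolding C_def base_component_def by (rule connected_component_maximal[rotated])
    moreover have "p = \<gamma> 1" by (simp add: \<gamma>_def p)
    ultimately show "p \<in> C" by auto
  qed
  moreover have "C \<subseteq> ?B"
  proof -
    have CL: "C \<subseteq> level_set h" unfolding C_def base_component_def by (rule connected_component_subset)
    have "C \<inter> ?B = C \<inter> {p. fst p > 0 \<and> snd p \<bullet> snd p < 3 * (fst p)\<^sup>2}"
      using CL by (auto simp: level_set_def)
    moreover have "open {p :: 'n xy_space. fst p > 0 \<and> snd p \<bullet> snd p < 3 * (fst p)\<^sup>2}"
      by (intro open_Collect_conj open_Collect_less continuous_intros)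
    ultimately have op: "openin (top_of_set C) (C \<inter> ?B)"
      by (simp only: openin_open_Int)
    have "C \<inter> ?B = C \<inter> {p. fst p \<ge> 0 \<and> snd p \<bullet> snd p \<le> 3 * (fst p)\<^sup>2}"
      unfolding eq using CL by (auto simp: level_set_def)
    moreover have "closed {p :: 'n xy_space. fst p \<ge> 0 \<and> snd p \<bullet> snd p \<le> 3 * (fst p)\<^sup>2}"
      by (intro closed_Collect_conj closed_Collect_le continuous_intros)
    ultimately have cl: "closedin (top_of_set C) (C \<inter> ?B)"
      by (simp only: closedin_closed_Int)
    have "connected C" unfolding C_def base_component_def by (rule connected_connected_component)
    then have "C \<inter> ?B = {} \<or> C \<inter> ?B = C"
      using op cl unfolding connected_clopen by blast
    moreover have "(1, 0) \<in> C \<inter> ?B"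
      using base by (auto simp: C_def base_component_def h)
    ultimately show ?thesis by blast
  qed
  ultimately show "base_component h = ?B" unfolding C_def by blast
  then show "base_component h = ?B'" using eq by blast
qed

proposition ccpsr_manifold_base_component:
  fixes h :: "'n::finite xy_space cubic"
  assumes sf: "standard_form h P" and P: "\<And>y. cubic_eval P y \<le> kappa * norm y ^ 3"
  shows "ccpsr_manifold h (base_component h)"
proof -
  have "cubic_eval h (1, 0) = 1" using sf by (simp add: standard_form_def)
  then have "(1, 0) \<in> base_component h"
    unfolding base_component_eq(1)[OF assms] by simp
  moreover have "openin (top_of_set (level_set h)) (base_component h)"
  proof -
    have "base_component h = level_set h \<inter> {p. fst p > 0 \<and> snd p \<bullet> snd p < 3 * (fst p)\<^sup>2}"
      unfolding base_component_eq(1)[OF assms] by (auto simp: level_set_def)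
    moreover have "open {p :: 'n xy_space. fst p > 0 \<and> snd p \<bullet> snd p < 3 * (fst p)\<^sup>2}"
      by (intro open_Collect_conj open_Collect_less continuous_intros)
    ultimately show ?thesis by (simp only: openin_open_Int)
  qed
  moreover have "hyperbolic_point h p" if "p \<in> base_component h" for p
    using that standard_form_hyperbolic[OF assms, of "fst p" "snd p"]
    unfolding base_component_eq(1)[OF assms] by simp
  moreover have "connected (base_component h)"
    unfolding base_component_def by (rule connected_connected_component)
  moreover have "closed (base_component h)"
    unfolding base_component_eq(2)[OF assms]
    by (intro closed_Collect_conj closed_Collect_le closed_Collect_eq continuous_intros)
  ultimately show ?thesis
    unfolding ccpsr_manifold_def psr_manifold_def by blast
qed

lemma ccpsr_manifold_component:
  assumes "ccpsr_manifold h H" "p \<in> H"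
  shows "connected_component_set (level_set h) p = H"
proof
  note H = assms(1)[unfolded ccpsr_manifold_def psr_manifold_def]
  have HL: "H \<subseteq> level_set h" using H openin_imp_subset by blast
  show "H \<subseteq> connected_component_set (level_set h) p"
    using H HL assms(2) by (intro connected_component_maximal) auto
  define C where "C = connected_component_set (level_set h) p"
  have CL: "C \<subseteq> level_set h" unfolding C_def by (rule connected_component_subset)
  obtain T where T: "open T" "H = level_set h \<inter> T"
    using H unfolding openin_open by blast
  have "C \<inter> H = C \<inter> T" using T(2) CL by blast
  then have "openin (top_of_set C) (C \<inter> H)" using T(1) by (simp add: openin_open_Int)
  moreover have "closedin (top_of_set C) (C \<inter> H)"
    using H by (intro closedin_closed_Int) auto
  moreover have "connected C" unfolding C_def by (rule connected_connected_component)
  moreover have "p \<in> C \<inter> H" using assms HL by (auto simp: C_def)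
  ultimately have "C \<inter> H = C"
    unfolding connected_clopen by blast
  then show "connected_component_set (level_set h) p \<subseteq> H" by (auto simp: C_def)
qed

lemma ccpsr_manifold_imp_bound:
  fixes h :: "'n::finite xy_space cubic"
  assumes cc: "ccpsr_manifold h H" and base: "(1, 0) \<in> H" and sf: "standard_form h P"
    and e: "norm e = 1"
  shows "cubic_eval P e \<le> kappa"
proof (rule ccontr)
  assume "\<not> cubic_eval P e \<le> kappa"
  define c where "c = cubic_eval P e"
  define f where "f = (\<lambda>s::real. 1 - s\<^sup>2 + c * s ^ 3)"
  have c: "c > kappa" using \<open>\<not> _\<close> by (simp add: c_def)
  have ee: "e \<bullet> e = 1" using e by (simp add: norm_eq_1)
  have h: "cubic_eval h (x, y) = x ^ 3 - x * (y \<bullet> y) + cubic_eval P y" for x y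
    using sf by (simp add: standard_form_def)
  have hf: "cubic_eval h (1, s *\<^sub>R e) = f s" for s
    by (simp add: h f_def cubic_eval_scale c_def ee power2_eq_square)
  have f: "f s > 0" if "s \<ge> 0" for s
  proof (cases "s = 0")
    case False
    define r where "r = s / sqrt 3"
    have s: "s = sqrt 3 * r" by (simp add: r_def)
    have "r \<ge> 0" using that by (simp add: r_def)
    have "kappa * s ^ 3 = 2 * r ^ 3"
      unfolding s power_mult_distrib by (simp add: power3_eq_cube)
    moreover have "s\<^sup>2 = 3 * r\<^sup>2" by (simp add: s power_mult_distrib)
    ultimately have "1 - s\<^sup>2 + kappa * s ^ 3 = 1 - 3 * r\<^sup>2 + 2 * r ^ 3"
      by (simp only:)
    also have "\<dots> = (1 - r)\<^sup>2 * (1 + 2 * r)"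
      by (simp add: power2_eq_square power3_eq_cube algebra_simps)
    also have "\<dots> \<ge> 0" using \<open>r \<ge> 0\<close> by simp
    finally have "1 - s\<^sup>2 + kappa * s ^ 3 \<ge> 0" .
    moreover have "kappa * s ^ 3 < c * s ^ 3"
      using c that False by (intro mult_strict_right_mono) auto
    ultimately show ?thesis by (simp add: f_def)
  qed (simp add: f_def)
  define \<gamma> where "\<gamma> = (\<lambda>s. inverse (root 3 (f s)) *\<^sub>R (1::real, s *\<^sub>R e))"
  have "continuous_on {0..} \<gamma>"
    unfolding \<gamma>_def f_def by (intro continuous_intros) (use f in \<open>force simp: f_def\<close>)
  then have "connected (\<gamma> ` {0..})" by (intro connected_continuous_image) auto
  moreover have "\<gamma> ` {0..} \<subseteq> level_set h"
  proof -
    have "cubic_eval h (\<gamma> s) = 1" if "s \<ge> 0" for s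
      using f[OF that] unfolding \<gamma>_def cubic_eval_scale hf
      by (simp add: power_inverse odd_real_root_pow)
    then show ?thesis by (auto simp: level_set_def)
  qed
  moreover have "(1, 0) \<in> \<gamma> ` {0..}"
    by (rule image_eqI[of _ _ 0]) (auto simp: \<gamma>_def f_def)
  ultimately have "\<gamma> ` {0..} \<subseteq> connected_component_set (level_set h) (1, 0)"
    by (rule connected_component_maximal[rotated])
  then have sub: "\<gamma> ` {0..} \<subseteq> H" using ccpsr_manifold_component[OF cc base] by simp
  define s where "s = 9 * c / 2"
  have "kappa > 0" by simp
  then have c0: "c > 0" using c by (rule less_trans)
  then have s0: "s \<ge> 0" by (simp add: s_def)
  define k where "k = inverse (root 3 (f s))"
  have k: "k > 0" using f[OF s0] by (simp add: k_def)
  have "\<gamma> s \<in> H" using sub s0 by auto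
  then have "hyperbolic_point h (k *\<^sub>R (1, s *\<^sub>R e))"
    using cc unfolding ccpsr_manifold_def psr_manifold_def \<gamma>_def k_def by auto
  then have hyp: "tri h (1, s *\<^sub>R e) v v < 0" if "tri h (1, s *\<^sub>R e) (1, s *\<^sub>R e) v = 0" "v \<noteq> 0" for v
    using that k unfolding hyperbolic_point_iff tri_scale_left tri_scale_middle
    by (metis mult_eq_0_iff mult_less_0_iff not_less_iff_gr_or_eq)
  define \<alpha> \<beta> where "\<alpha> = 2 * s - 3 * c * s\<^sup>2" and "\<beta> = 3 - s\<^sup>2"
  have triP: "tri P e e e = c" by (simp add: tri_diag c_def)
  have T: "tri h (1, s *\<^sub>R e) (a, b *\<^sub>R e) (a', b' *\<^sub>R e) =
      a * a' - (b * b' + s * (a * b' + a' * b)) / 3 + s * b * b' * c" for a b a' b'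
    unfolding standard_form_tri[OF sf] by (simp add: tri_linear triP ee algebra_simps)
  have "tri h (1, s *\<^sub>R e) (1, s *\<^sub>R e) (\<alpha>, \<beta> *\<^sub>R e) = 0"
    unfolding T \<alpha>_def \<beta>_def by (simp add: power2_eq_square field_simps)
  moreover have "(\<alpha>, \<beta> *\<^sub>R e) \<noteq> 0"
  proof
    assume "(\<alpha>, \<beta> *\<^sub>R e) = 0"
    then have "\<alpha> = 0" "\<beta> = 0" using e by (auto simp: zero_prod_def)
    moreover have "\<beta> - s * \<alpha> = 3 * f s"
      by (simp add: \<alpha>_def \<beta>_def f_def power2_eq_square power3_eq_cube algebra_simps)
    ultimately show False using f[OF s0] by simp
  qed
  ultimately have "tri h (1, s *\<^sub>R e) (\<alpha>, \<beta> *\<^sub>R e) (\<alpha>, \<beta> *\<^sub>R e) < 0" by (rule hyp)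
  moreover have "tri h (1, s *\<^sub>R e) (\<alpha>, \<beta> *\<^sub>R e) (\<alpha>, \<beta> *\<^sub>R e) = f s * (9 * c * s - 3 - s\<^sup>2)"
    unfolding T \<alpha>_def \<beta>_def f_def
    by (simp add: power2_eq_square power3_eq_cube field_simps)
  moreover have "9 * c * s - 3 - s\<^sup>2 > 0"
  proof -
    have "kappa\<^sup>2 < c\<^sup>2" using c \<open>kappa > 0\<close> by (intro power_strict_mono) auto
    then have "c\<^sup>2 > 4 / 27" by (simp add: power_divide power_mult_distrib)
    then show ?thesis by (simp add: s_def power2_eq_square field_simps)
  qed
  ultimately show False using f[OF s0] by (simp add: mult_less_0_iff)
qed

lemma standard_form_exists:
  fixes h :: "'n::finite xy_space cubic"
  assumes hyp: "hyperbolic_point h p" and p1: "cubic_eval h p = 1"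
  obtains A :: "'n xy_space \<Rightarrow> 'n xy_space" and h' P where "linear A" "bij A" "A (1, 0) = p" "cubic_eval h \<circ> A = cubic_eval h'"
    "standard_form h' P"
proof -
  define B where "B = (\<lambda>u v. - 3 * tri h p u v)"
  have B: "bilinear B" "\<And>u v. B u v = B v u"
    unfolding B_def by (rule bilinear_tri) (simp add: tri_commute23)
  have "B p p < 0" "\<And>v. B p v = 0 \<Longrightarrow> v \<noteq> 0 \<Longrightarrow> B v v > 0"
    using hyp p1 by (auto simp: B_def tri_diag hyperbolic_point_iff)
  from lorentz_adapted_basis[OF B this] obtain Q where Q: "finite Q" "card Q = DIM('n xy_space) - 1"
    "span (insert p Q) = UNIV" "\<And>u. u \<in> Q \<Longrightarrow> B p u = 0" "\<And>u. u \<in> Q \<Longrightarrow> B u u > 0"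
    "\<And>u v. u \<in> Q \<Longrightarrow> v \<in> Q \<Longrightarrow> u \<noteq> v \<Longrightarrow> B u v = 0"
    by metis
  have "card Q = CARD('n)" using Q(2) by simp
  then obtain \<beta> :: "'n \<Rightarrow> 'n xy_space" where \<beta>: "bij_betw \<beta> UNIV Q"
    using finite_same_card_bij[of "UNIV :: 'n set" Q] Q(1) by auto
  then have \<beta>Q: "\<beta> i \<in> Q" for i by (auto simp: bij_betw_def)
  define e where "e = (\<lambda>i. inverse (sqrt (B (\<beta> i) (\<beta> i))) *\<^sub>R \<beta> i)"
  have Be: "B (e i) (e j) = (if i = j then 1 else 0)" for i j
  proof (cases "i = j")
    case True
    have "B (\<beta> i) (\<beta> i) > 0" using Q(5) \<beta>Q by blast
    then show ?thesis
      using True by (simp add: e_def bilinear_lmul[OF B(1)] bilinear_rmul[OF B(1)] field_simps)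
  next
    case False
    then have "\<beta> i \<noteq> \<beta> j" using \<beta> by (auto simp: bij_betw_def inj_def)
    then show ?thesis
      using False Q(6)[OF \<beta>Q \<beta>Q] by (simp add: e_def bilinear_lmul[OF B(1)] bilinear_rmul[OF B(1)])
  qed
  have pe: "B p (e i) = 0" for i
    using Q(4)[OF \<beta>Q] by (simp add: e_def bilinear_rmul[OF B(1)])
  define E :: "real ^ 'n \<Rightarrow> 'n xy_space" where "E = (\<lambda>y. \<Sum>i\<in>UNIV. (y $ i) *\<^sub>R e i)"
  have linE: "linear E"
    unfolding E_def by (intro linearI) (simp_all add: scaleR_left_distrib sum.distrib scaleR_sum_right)
  define A :: "'n xy_space \<Rightarrow> 'n xy_space" where "A = (\<lambda>q. E (snd q) + fst q *\<^sub>R p)"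
  have linA: "linear A"
    unfolding A_def by (intro linearI) (simp_all add: linear_add[OF linE] linear_cmul[OF linE] algebra_simps)
  have "surj A"
  proof -
    have "\<beta> i \<in> range A" for i
    proof
      have "B (\<beta> i) (\<beta> i) > 0" using Q(5) \<beta>Q by blast
      moreover have "E (axis i c) = c *\<^sub>R e i" for c
        unfolding E_def by (simp add: axis_def if_distrib[of "\<lambda>x. x *\<^sub>R _"] sum.delta cong: if_cong)
      ultimately show "\<beta> i = A (0, axis i (sqrt (B (\<beta> i) (\<beta> i))))"
        by (simp add: A_def e_def)
    qed simp
    moreover have "p \<in> range A"
      by (rule image_eqI[of _ _ "(1, 0)"]) (auto simp: A_def linear_0[OF linE])
    moreover have "Q = range \<beta>" using \<beta> by (simp add: bij_betw_def)
    ultimately have "insert p Q \<subseteq> range A" by blast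
    moreover have "subspace (range A)" using linA by (simp add: linear_subspace_image)
    ultimately have "span (insert p Q) \<subseteq> range A" by (rule span_minimal)
    then show ?thesis using Q(3) by auto
  qed
  then have bijA: "bij A"
    using linear_surjective_imp_injective[OF linA] by (simp add: bij_def)
  obtain h' where h': "\<And>q. cubic_eval h' q = cubic_eval h (A q)"
    by (rule cubic_eval_compose_linear[OF linA]) blast
  obtain P where P: "\<And>y. cubic_eval P y = cubic_eval h (E y)"
    by (rule cubic_eval_compose_linear[OF linE]) blast
  have "cubic_eval h' (x, y) = x ^ 3 - x * (y \<bullet> y) + cubic_eval P y" for x y
  proof -
    have pE: "B p (E y) = 0"
      unfolding E_def using bilinear_sum[OF B(1), of "\<lambda>_. p" "{()}"  "\<lambda>i. (y $ i) *\<^sub>R e i" UNIV]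
      by (simp add: sum.cartesian_product[symmetric] bilinear_rmul[OF B(1)] pe)
    have "B (E y) (E y) = (\<Sum>i\<in>UNIV. \<Sum>j\<in>UNIV. y $ j * (y $ i * B (e i) (e j)))"
      unfolding E_def using bilinear_sum[OF B(1), of "\<lambda>i. (y $ i) *\<^sub>R e i" UNIV "\<lambda>i. (y $ i) *\<^sub>R e i" UNIV]
      by (simp add: sum.cartesian_product bilinear_lmul[OF B(1)] bilinear_rmul[OF B(1)])
    also have "\<dots> = (\<Sum>i\<in>UNIV. \<Sum>j\<in>UNIV. if j = i then y $ i * y $ i else 0)"
      by (intro sum.cong refl) (auto simp: Be)
    also have "\<dots> = y \<bullet> y" by (simp add: inner_vec_def)
    finally have EE: "y \<bullet> y = - 3 * tri h p (E y) (E y)" by (simp add: B_def)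
    have "cubic_eval h' (x, y) = cubic_eval h (E y + x *\<^sub>R p)"
      by (simp add: h' A_def)
    also have "\<dots> = x ^ 3 - x * (y \<bullet> y) + cubic_eval P y"
      unfolding cubic_eval_add_scale EE using pE p1
      by (simp add: B_def P tri_commute12[of h "E y" p] tri_commute23[of h "E y" "E y" p]
          tri_commute23[of h p "E y" p])
    finally show ?thesis .
  qed
  then have "standard_form h' P" by (simp add: standard_form_def)
  moreover have "A (1, 0) = p" by (simp add: A_def linear_0[OF linE])
  moreover have "cubic_eval h \<circ> A = cubic_eval h'" by (simp add: fun_eq_iff h')
  ultimately show ?thesis by (intro that[OF linA bijA])
qed

subsection \<open>The maximum norm on cubics\<close>

lemma topological_submanifold_gauge_sphere:
  fixes L :: "real ^ 'm::finite \<Rightarrow> 'v::euclidean_space" and M :: "real ^ 'm \<Rightarrow> real"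
  assumes L: "linear L" "inj L" and contM: "continuous_on UNIV M"
    and M: "\<And>t x. t > 0 \<Longrightarrow> M (t *\<^sub>R x) = t * M x" "\<And>x. x \<noteq> 0 \<Longrightarrow> M x > 0" and k: "k > 0"
  shows "topological_submanifold (CARD('m) - 1) ((\<lambda>x. a + L x) ` {x. M x = k})"
proof -
  obtain R where R: "linear R" "\<And>x. R (L x) = x"
    using linear_injective_left_inverse[OF L] by (metis comp_eq_dest_lhs id_apply)
  define b :: "real ^ 'm" where "b = axis undefined 1"
  have bb: "b \<bullet> b = 1" by (simp add: b_def inner_axis_axis)
  define V where "V = L ` {q. b \<bullet> q = 0}"
  define S where "S = (\<lambda>x. a + L x) ` {x. M x = k}"
  have "subspace V"
    unfolding V_def by (intro linear_subspace_image L subspace_hyperplane)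
  have "dim V = CARD('m) - 1"
  proof -
    have "dim V = dim {q. b \<bullet> q = 0}"
      unfolding V_def by (rule dim_image_eq[OF L(1) inj_on_subset[OF L(2) subset_UNIV]])
    moreover have "b \<noteq> 0" using bb by auto
    then have "dim {q. b \<bullet> q = 0} = CARD('m) - 1"
      using dim_hyperplane[of b] bb by simp
    ultimately show ?thesis by simp
  qed
  have M0: "M 0 = 0" using M(1)[of 2 0] by simp
  have "\<exists>W W' F G. open W \<and> p \<in> W \<and> open W' \<and> homeomorphism W W' F G \<and> F ` (W \<inter> S) = W' \<inter> V"
    if "p \<in> S" for p
  proof -
    obtain x0 where x0: "p = a + L x0" "M x0 = k" using \<open>p \<in> S\<close> by (auto simp: S_def)
    then have "x0 \<noteq> 0" using k M0 by auto
    then have "norm (x0 /\<^sub>R norm x0) = norm b" using bb by (simp add: norm_eq_1)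
    then obtain f where f: "orthogonal_transformation f" "f (x0 /\<^sub>R norm x0) = b"
      by (rule orthogonal_transformation_exists)
    define g where "g = inv f"
    have linf: "linear f" using f(1) by (rule orthogonal_transformation_linear)
    have bijf: "bij f" using f(1) by (rule orthogonal_transformation_bij)
    have ling: "linear g" unfolding g_def by (rule linear_bij_inv[OF linf bijf])
    have fg: "f (g x) = x" "g (f x) = x" for x
      using bijf by (simp_all add: g_def bij_is_surj surj_f_inv_f bij_is_inj)
    have fx0: "f x0 \<bullet> b > 0"
    proof -
      have "f x0 = norm x0 *\<^sub>R b"
        using arg_cong[OF f(2), of "scaleR (norm x0)"] \<open>x0 \<noteq> 0\<close> by (simp add: linear_cmul[OF linf])
      then show ?thesis using bb \<open>x0 \<noteq> 0\<close> by simp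
    qed
    define c where "c = (\<lambda>x. f x \<bullet> b)"
    define \<psi> where "\<psi> = (\<lambda>x. (M x - k) *\<^sub>R b + (1 / c x) *\<^sub>R (f x - c x *\<^sub>R b))"
    define u where "u = (\<lambda>r. g (b + (r - (r \<bullet> b) *\<^sub>R b)))"
    define \<phi> where "\<phi> = (\<lambda>r. ((r \<bullet> b + k) / M (u r)) *\<^sub>R u r)"
    have cu: "c (u r) = 1" for r
      by (simp add: c_def u_def fg inner_add_left inner_diff_left bb)
    have Mpos: "M x > 0" if "c x > 0" for x
      using that M(2)[of x] linear_0[OF linf] by (cases "x = 0") (auto simp: c_def)
    have Mu: "M (u r) > 0" for r using Mpos cu by simp
    have \<psi>b: "\<psi> x \<bullet> b = M x - k" for x
      by (simp add: \<psi>_def inner_add_left inner_diff_left bb c_def)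
    have \<phi>\<psi>: "\<phi> (\<psi> x) = x" if "c x > 0" for x
    proof -
      have "b + (\<psi> x - (\<psi> x \<bullet> b) *\<^sub>R b) = (1 / c x) *\<^sub>R f x"
        unfolding \<psi>b using that by (simp add: \<psi>_def algebra_simps)
      then have "u (\<psi> x) = (1 / c x) *\<^sub>R x"
        by (simp add: u_def linear_cmul[OF ling] fg)
      then show ?thesis
        unfolding \<phi>_def \<psi>b using that Mpos[OF that] by (simp add: M(1))
    qed
    have c\<phi>: "c (\<phi> r) > 0" and M\<phi>: "M (\<phi> r) = r \<bullet> b + k" and \<psi>\<phi>: "\<psi> (\<phi> r) = r" if "r \<bullet> b > - k" for r
    proof -
      have s: "(r \<bullet> b + k) / M (u r) > 0" using that Mu by simp
      have c: "c (\<phi> r) = (r \<bullet> b + k) / M (u r)"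
        using cu[of r] by (simp add: \<phi>_def c_def linear_cmul[OF linf])
      then show "c (\<phi> r) > 0" using s by simp
      show M: "M (\<phi> r) = r \<bullet> b + k"
        unfolding \<phi>_def M(1)[OF s] using Mu[of r] by simp
      have "f (\<phi> r) = c (\<phi> r) *\<^sub>R (b + (r - (r \<bullet> b) *\<^sub>R b))"
      proof -
        have "f (u r) = b + (r - (r \<bullet> b) *\<^sub>R b)" by (simp add: u_def fg)
        moreover have "f (\<phi> r) = ((r \<bullet> b + k) / M (u r)) *\<^sub>R f (u r)"
          by (simp only: \<phi>_def linear_cmul[OF linf])
        ultimately show ?thesis by (simp only: c)
      qed
      then have "(1 / c (\<phi> r)) *\<^sub>R f (\<phi> r) = b + (r - (r \<bullet> b) *\<^sub>R b)"
        using \<open>c (\<phi> r) > 0\<close> by simp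
      then show "\<psi> (\<phi> r) = r"
        using \<open>c (\<phi> r) > 0\<close> by (simp add: \<psi>_def M scaleR_diff_right)
    qed
    have contf: "continuous_on X f" "continuous_on X g" "continuous_on Y L" "continuous_on Z R" for X Y Z
      using linf ling L R by (auto intro!: linear_continuous_on simp: linear_conv_bounded_linear)
    note cont = continuous_on_compose2[OF contf(1)[of UNIV]] continuous_on_compose2[OF contf(2)[of UNIV]]
      continuous_on_compose2[OF contf(3)[of UNIV]] continuous_on_compose2[OF contf(4)[of UNIV]]
      continuous_on_compose2[OF contM]
    define W where "W = {h. c (R (h - a)) > 0}"
    define W' where "W' = {h. R h \<bullet> b > - k}"
    define F where "F = (\<lambda>h. L (\<psi> (R (h - a))) + (h - a - L (R (h - a))))"
    define G where "G = (\<lambda>h. a + L (\<phi> (R h)) + (h - L (R h)))"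
    have RF: "R (F h) = \<psi> (R (h - a))" for h
      by (simp add: F_def linear_add[OF R(1)] linear_diff[OF R(1)] R(2))
    have RG: "R (G h - a) = \<phi> (R h)" for h
      by (simp add: G_def linear_add[OF R(1)] linear_diff[OF R(1)] R(2))
    have GF: "G (F h) = h" if "h \<in> W" for h
      using that \<phi>\<psi>[of "R (h - a)"] unfolding G_def RF by (simp add: W_def) (simp add: F_def)
    have FG: "F (G h) = h" if "h \<in> W'" for h
      using that \<psi>\<phi>[of "R h"] unfolding F_def RG by (simp add: W'_def) (simp add: G_def)
    have FW: "F h \<in> W'" if "h \<in> W" for h
      using that Mpos[of "R (h - a)"] by (simp add: W'_def W_def RF \<psi>b)
    have GW: "G h \<in> W" if "h \<in> W'" for h
      using that c\<phi>[of "R h"] by (simp add: W'_def W_def RG)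
    have "homeomorphism W W' F G"
    proof (rule homeomorphismI)
      show "continuous_on W F"
        unfolding F_def \<psi>_def c_def by (intro continuous_intros cont) (auto simp: W_def c_def)
      show "continuous_on W' G"
        unfolding G_def \<phi>_def u_def
        by (intro continuous_intros cont) (use Mu in \<open>auto simp: u_def less_imp_neq[symmetric]\<close>)
    qed (use GF FG FW GW in auto)
    moreover have "open W"
      unfolding W_def c_def by (intro open_Collect_less continuous_intros cont) auto
    moreover have "open W'"
      unfolding W'_def by (intro open_Collect_less continuous_intros cont) auto
    moreover have "p \<in> W" using fx0 by (simp add: W_def x0 R c_def)
    moreover have "F ` (W \<inter> S) = W' \<inter> V"
    proof
      show "F ` (W \<inter> S) \<subseteq> W' \<inter> V"
      proof (rule image_subsetI)
        fix h assume h: "h \<in> W \<inter> S"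
        then obtain x where x: "h = a + L x" "M x = k" by (auto simp: S_def)
        have "F h = L (\<psi> x)" by (simp add: F_def x R)
        moreover have "b \<bullet> \<psi> x = 0" using \<psi>b[of x] x by (simp add: inner_commute)
        ultimately have "F h \<in> V" unfolding V_def by blast
        then show "F h \<in> W' \<inter> V" using FW h by blast
      qed
      show "W' \<inter> V \<subseteq> F ` (W \<inter> S)"
      proof
        fix h assume h: "h \<in> W' \<inter> V"
        then obtain q where q: "h = L q" "b \<bullet> q = 0" by (auto simp: V_def)
        then have "M (\<phi> q) = k" using M\<phi>[of q] k by (simp add: inner_commute)
        then have "G h \<in> S" by (auto simp: G_def q R S_def)
        then show "h \<in> F ` (W \<inter> S)" using h FG GW by (metis IntE IntI image_eqI)
      qed
    qed
    ultimately show ?thesis by blast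
  qed
  with \<open>subspace V\<close> \<open>dim V = CARD('m) - 1\<close> show ?thesis
    unfolding topological_submanifold_def S_def by blast
qed

definition sup_sphere :: "'a::euclidean_space cubic \<Rightarrow> real" where
  "sup_sphere P = (SUP y\<in>sphere 0 1. cubic_eval P y)"

lemma sup_sphere_attained:
  fixes P :: "'a::euclidean_space cubic"
  obtains e where "norm e = 1" "sup_sphere P = cubic_eval P e"
    "\<And>y. norm y = 1 \<Longrightarrow> cubic_eval P y \<le> sup_sphere P"
proof -
  have "sphere (0::'a) 1 \<noteq> {}" by simp
  then obtain e where e: "e \<in> sphere 0 1" "\<And>y. y \<in> sphere 0 1 \<Longrightarrow> cubic_eval P y \<le> cubic_eval P e"
    using continuous_attains_sup[of "sphere (0::'a) 1" "cubic_eval P"]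
      continuous_on_cubic_eval[OF continuous_on_id, of _ P] by (metis compact_sphere)
  then have "sup_sphere P = cubic_eval P e"
    unfolding sup_sphere_def by (intro cSup_eq_maximum) auto
  with e show ?thesis by (intro that[of e]) auto
qed

lemma sup_sphere_le_iff: "sup_sphere P \<le> c \<longleftrightarrow> (\<forall>y. cubic_eval P y \<le> c * norm y ^ 3)"
proof
  assume c: "sup_sphere P \<le> c"
  show "\<forall>y. cubic_eval P y \<le> c * norm y ^ 3"
  proof
    fix y
    show "cubic_eval P y \<le> c * norm y ^ 3"
    proof (cases "y = 0")
      case False
      define z where "z = inverse (norm y) *\<^sub>R y"
      have "cubic_eval P z \<le> c"
        using sup_sphere_attained[of P] c False by (metis z_def norm_scaleR abs_inverse abs_norm_cancel
            left_inverse norm_eq_zero order_trans)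
      then have "norm y ^ 3 * cubic_eval P z \<le> norm y ^ 3 * c" by (intro mult_left_mono) auto
      moreover have "y = norm y *\<^sub>R z" using False by (simp add: z_def)
      ultimately show ?thesis by (metis cubic_eval_scale mult.commute)
    qed simp
  qed
next
  assume "\<forall>y. cubic_eval P y \<le> c * norm y ^ 3"
  then show "sup_sphere P \<le> c"
    using sup_sphere_attained[of P] by (metis mult.right_neutral power_one)
qed

lemma sup_sphere_scale:
  assumes "t \<ge> 0" shows "sup_sphere (t *\<^sub>R P) = t * sup_sphere P"
proof (rule antisym)
  obtain e where e: "norm e = 1" "sup_sphere (t *\<^sub>R P) = cubic_eval (t *\<^sub>R P) e"
    by (rule sup_sphere_attained)
  show "sup_sphere (t *\<^sub>R P) \<le> t * sup_sphere P"
    using e assms sup_sphere_attained[of P] by (metis cubic_eval_linear_coeff(2) mult_left_mono)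
  obtain e where e: "norm e = 1" "sup_sphere P = cubic_eval P e"
    by (rule sup_sphere_attained)
  show "t * sup_sphere P \<le> sup_sphere (t *\<^sub>R P)"
    using e sup_sphere_attained[of "t *\<^sub>R P"] by (metis cubic_eval_linear_coeff(2))
qed

lemma sup_sphere_add: "sup_sphere (P + Q) \<le> sup_sphere P + sup_sphere Q"
proof -
  obtain e where e: "norm e = 1" "sup_sphere (P + Q) = cubic_eval (P + Q) e"
    by (rule sup_sphere_attained)
  show ?thesis
    using e sup_sphere_attained[of P] sup_sphere_attained[of Q]
    by (metis cubic_eval_linear_coeff(1) add_mono)
qed

lemma sup_sphere_zero [simp]: "sup_sphere 0 = 0"
  using sup_sphere_scale[of 0 0] by simp

text \<open>A cubic is odd, so its maximum on the sphere is also the maximum of its absolute value.\<close>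

lemma sup_sphere_pos:
  fixes P :: "'a::euclidean_space cubic"
  assumes "P \<noteq> 0" shows "sup_sphere P > 0"
proof (rule ccontr)
  assume "\<not> sup_sphere P > 0"
  then have "\<forall>y. cubic_eval P y \<le> 0 * norm y ^ 3"
    using sup_sphere_le_iff[of P 0] by simp
  then have *: "cubic_eval P y \<le> 0" for y by simp
  have "cubic_eval P y = 0" for y
    using *[of y] *[of "- y"] by simp
  then have "cubic_eval P = cubic_eval 0" by (simp add: fun_eq_iff cubic_eval_def[of 0])
  with assms show False by (simp add: cubic_eval_inject)
qed

lemma convex_on_sup_sphere: "convex_on UNIV (sup_sphere :: 'a::euclidean_space cubic \<Rightarrow> real)"
proof (rule convex_onI)
  fix t :: real and P Q :: "'a cubic" assume "0 < t" "t < 1"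
  then show "sup_sphere ((1 - t) *\<^sub>R P + t *\<^sub>R Q) \<le> (1 - t) * sup_sphere P + t * sup_sphere Q"
    using sup_sphere_add[of "(1 - t) *\<^sub>R P" "t *\<^sub>R Q"] by (simp add: sup_sphere_scale)
qed simp

lemma continuous_on_sup_sphere: "continuous_on UNIV (sup_sphere :: 'a::euclidean_space cubic \<Rightarrow> real)"
  by (rule convex_on_continuous[OF open_UNIV convex_on_sup_sphere])

lemma convex_sup_sphere_le: "convex {P :: 'a::euclidean_space cubic. sup_sphere P \<le> c}"
proof (rule convexI)
  fix P Q :: "'a cubic" and u v :: real
  assume PQ: "P \<in> {P. sup_sphere P \<le> c}" "Q \<in> {P. sup_sphere P \<le> c}" and uv: "0 \<le> u" "0 \<le> v" "u + v = 1"
  have "sup_sphere (u *\<^sub>R P + v *\<^sub>R Q) \<le> u * sup_sphere P + v * sup_sphere Q"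
    using sup_sphere_add[of "u *\<^sub>R P" "v *\<^sub>R Q"] uv by (simp add: sup_sphere_scale)
  also have "\<dots> \<le> c" using PQ uv by (intro convex_bound_le) auto
  finally show "u *\<^sub>R P + v *\<^sub>R Q \<in> {P. sup_sphere P \<le> c}" by simp
qed

lemma compact_sup_sphere_le: "compact {P :: 'a::euclidean_space cubic. sup_sphere P \<le> c}"
proof -
  have "\<exists>P0\<in>sphere 0 1. \<forall>P\<in>sphere 0 1. sup_sphere (P0 :: 'a cubic) \<le> sup_sphere (P :: 'a cubic)"
    by (rule continuous_attains_inf)
      (auto intro: continuous_on_subset[OF continuous_on_sup_sphere])
  then obtain P0 :: "'a cubic" where P0: "norm P0 = 1" "\<And>P :: 'a cubic. norm P = 1 \<Longrightarrow> sup_sphere P0 \<le> sup_sphere P"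
    by auto
  define m where "m = sup_sphere P0"
  have m: "m > 0" using P0(1) unfolding m_def by (intro sup_sphere_pos) auto
  have "m * norm P \<le> sup_sphere P" for P :: "'a cubic"
  proof (cases "P = 0")
    case False
    have "m \<le> sup_sphere (inverse (norm P) *\<^sub>R P)"
      using False unfolding m_def by (intro P0) auto
    also have "\<dots> = inverse (norm P) * sup_sphere P" by (simp add: sup_sphere_scale)
    finally show ?thesis using False by (simp add: field_simps)
  qed simp
  then have "norm P \<le> c / m" if "sup_sphere P \<le> c" for P :: "'a cubic"
    using that m by (metis mult.commute order_trans pos_le_divide_eq)
  then have "bounded {P :: 'a cubic. sup_sphere P \<le> c}"
    by (auto simp: bounded_iff)
  moreover have "closed {P :: 'a cubic. sup_sphere P \<le> c}"
    by (intro closed_Collect_le continuous_on_sup_sphere continuous_intros)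
  ultimately show ?thesis by (simp add: compact_eq_bounded_closed)
qed

lemma frontier_sup_sphere_le:
  assumes "c > 0"
  shows "frontier {P :: 'a::euclidean_space cubic. sup_sphere P \<le> c} = {P. sup_sphere P = c}" (is "frontier ?D = _")
proof -
  have "interior ?D = {P. sup_sphere P < c}"
  proof
    have "open {P :: 'a cubic. sup_sphere P < c}"
      by (intro open_Collect_less continuous_on_sup_sphere continuous_intros)
    then show "{P. sup_sphere P < c} \<subseteq> interior ?D"
      by (intro interior_maximal) auto
    show "interior ?D \<subseteq> {P. sup_sphere P < c}"
    proof
      fix P :: "'a cubic" assume P: "P \<in> interior ?D"
      then have "sup_sphere P \<le> c" using interior_subset by blast
      moreover have "sup_sphere P \<noteq> c"
      proof
        assume eq: "sup_sphere P = c"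
        have "((\<lambda>t. t *\<^sub>R P) \<longlongrightarrow> 1 *\<^sub>R P) (at_right 1)" by (intro tendsto_intros)
        then have "\<forall>\<^sub>F t in at_right 1. t *\<^sub>R P \<in> interior ?D"
          using P by (intro topological_tendstoD) auto
        then obtain t where "t > 1" "t *\<^sub>R P \<in> interior ?D"
          unfolding eventually_at_right_field by (metis dense)
        then have "t * c \<le> c" using interior_subset[of ?D] by (auto simp: sup_sphere_scale eq)
        then show False using \<open>t > 1\<close> assms by simp
      qed
      ultimately show "P \<in> {P. sup_sphere P < c}" by simp
    qed
  qed
  moreover have "closed ?D" using compact_sup_sphere_le compact_imp_closed by blast
  ultimately show ?thesis by (auto simp: frontier_def)
qed

lemma standard_form_parametrization:
  obtains h0 :: "'n::finite xy_space cubic" and L where "linear L" "inj L"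
    "\<And>h P. standard_form h P \<longleftrightarrow> h = h0 + L P"
proof -
  define T :: "'n xy_space \<Rightarrow> 'n xy_space \<Rightarrow> 'n xy_space \<Rightarrow> real" where
    "T = (\<lambda>p q r. fst p * fst q * fst r -
      (fst p * (snd q \<bullet> snd r) + fst q * (snd p \<bullet> snd r) + fst r * (snd p \<bullet> snd q)) / 3)"
  obtain h0 where h0: "\<And>p. cubic_eval h0 p = T p p p"
    by (rule cubic_of_trilinear[of T])
      (auto intro!: linearI simp: T_def inner_add_left inner_add_right field_simps)
  have "\<forall>P :: (real ^ 'n) cubic. \<exists>h :: 'n xy_space cubic. \<forall>p. cubic_eval h p = cubic_eval P (snd p)"
    by (metis cubic_eval_compose_linear linear_snd)
  then obtain L :: "(real ^ 'n) cubic \<Rightarrow> 'n xy_space cubic"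
    where L: "\<And>P p. cubic_eval (L P) p = cubic_eval P (snd p)" by metis
  have "linear L"
    by (rule linearI; subst cubic_eval_inject[symmetric]; simp add: fun_eq_iff L cubic_eval_linear_coeff)
  moreover have "inj L"
  proof (rule injI)
    fix P Q assume "L P = L Q"
    then have "cubic_eval P y = cubic_eval Q y" for y
      using L[of P "(0, y)"] L[of Q "(0, y)"] by simp
    then show "P = Q" by (subst cubic_eval_inject[symmetric]) (simp add: fun_eq_iff)
  qed
  moreover have "standard_form h P \<longleftrightarrow> h = h0 + L P" for h P
  proof -
    have "h = h0 + L P \<longleftrightarrow> (\<forall>p. cubic_eval h p = cubic_eval (h0 + L P) p)"
      by (metis cubic_eval_inject ext)
    then show ?thesis
      by (simp add: standard_form_def cubic_eval_linear_coeff h0 L T_def power3_eq_cube mult.assoc)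
  qed
  ultimately show ?thesis by (rule that)
qed

lemma choose_three: "6 * real ((n + 2) choose 3) = real n ^ 3 + 3 * real n ^ 2 + 2 * real n"
proof -
  have 2: "2 * real ((n + 2) choose 2) = (real n + 2) * (real n + 1)" for n
    by (induction n) (simp_all add: numeral_2_eq_2 algebra_simps)
  show ?thesis
  proof (induction n)
    case (Suc n)
    have "6 * real ((Suc n + 2) choose 3) = 3 * (2 * real ((n + 2) choose 2)) + 6 * real ((n + 2) choose 3)"
      by (simp add: numeral_3_eq_3 numeral_2_eq_2)
    then show ?case
      unfolding 2 Suc by (simp add: power2_eq_square power3_eq_cube algebra_simps)
  qed simp
qed

subsection \<open>The boundary of the cone\<close>

lemma spanned_cone_base_component:
  fixes h :: "'n::finite xy_space cubic"
  assumes sf: "standard_form h P" and P: "\<And>y. cubic_eval P y \<le> kappa * norm y ^ 3"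
  shows "spanned_cone (base_component h) =
    {p. fst p > 0 \<and> snd p \<bullet> snd p < 3 * (fst p)\<^sup>2 \<and> cubic_eval h p > 0}" (is "_ = ?U")
proof -
  have scale: "t *\<^sub>R p \<in> ?U" if "t > 0" "p \<in> ?U" for t p
    using that by (auto simp: cubic_eval_scale power_mult_distrib power2_eq_square)
  show ?thesis
  proof
    show "spanned_cone (base_component h) \<subseteq> ?U"
      unfolding spanned_cone_def base_component_eq(1)[OF assms] using scale by auto
    show "?U \<subseteq> spanned_cone (base_component h)"
    proof
      fix p assume p: "p \<in> ?U"
      define k where "k = root 3 (cubic_eval h p)"
      have k: "k > 0" "k ^ 3 = cubic_eval h p"
        using p by (auto simp: k_def odd_real_root_pow)
      have "inverse k *\<^sub>R p \<in> ?U" using k p by (intro scale) auto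
      moreover have "cubic_eval h (inverse k *\<^sub>R p) = 1"
        using k p unfolding cubic_eval_scale by (simp add: power_inverse)
      ultimately have "inverse k *\<^sub>R p \<in> base_component h"
        unfolding base_component_eq(1)[OF assms] by blast
      moreover have "p = k *\<^sub>R (inverse k *\<^sub>R p)" using k by simp
      ultimately show "p \<in> spanned_cone (base_component h)"
        unfolding spanned_cone_def using k(1) by blast
    qed
  qed
qed

lemma cubic_eval_axis_shift:
  assumes sf: "standard_form h P"
  shows "cubic_eval h (x + l, y) =
    cubic_eval h (x, y) + l * (3 * x\<^sup>2 - y \<bullet> y) + 3 * l\<^sup>2 * x + l ^ 3"
proof -
  have h: "cubic_eval h (x, y) = x ^ 3 - x * (y \<bullet> y) + cubic_eval P y" for x y
    using sf by (simp add: standard_form_def)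
  show ?thesis unfolding h by (simp add: power2_eq_square power3_eq_cube algebra_simps)
qed

lemma axis_shift_in_cone:
  fixes h :: "'n::finite xy_space cubic"
  assumes sf: "standard_form h P"
    and p: "x \<ge> 0" "y \<bullet> y \<le> 3 * x\<^sup>2" "cubic_eval h (x, y) = 0" and l: "l > 0"
  shows "x + l > 0" "y \<bullet> y < 3 * (x + l)\<^sup>2" "cubic_eval h (x + l, y) > 0"
proof -
  show "x + l > 0" using p l by simp
  have "x\<^sup>2 < (x + l)\<^sup>2" using p l by (intro power_strict_mono) auto
  then show "y \<bullet> y < 3 * (x + l)\<^sup>2" using p(2) by simp
  have "l * (3 * x\<^sup>2 - y \<bullet> y) \<ge> 0" "3 * l\<^sup>2 * x \<ge> 0" "l ^ 3 > 0" using p l by auto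
  then show "cubic_eval h (x + l, y) > 0"
    unfolding cubic_eval_axis_shift[OF sf] p(3) by linarith
qed

lemma frontier_spanned_cone:
  fixes h :: "'n::finite xy_space cubic"
  assumes sf: "standard_form h P" and P: "\<And>y. cubic_eval P y \<le> kappa * norm y ^ 3"
  shows "frontier (spanned_cone (base_component h)) - {0} =
    {p. fst p > 0 \<and> snd p \<bullet> snd p \<le> 3 * (fst p)\<^sup>2 \<and> cubic_eval h p = 0}"
proof -
  define U where "U = spanned_cone (base_component h)"
  have U: "U = {p. fst p > 0 \<and> snd p \<bullet> snd p < 3 * (fst p)\<^sup>2 \<and> cubic_eval h p > 0}"
    unfolding U_def by (rule spanned_cone_base_component[OF assms])
  have axis: "x > 0" if "x \<ge> 0" "y \<bullet> y \<le> 3 * x\<^sup>2" "(x, y) \<noteq> 0" for x and y :: "real ^ 'n"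
  proof (rule ccontr)
    assume "\<not> x > 0"
    then have "x = 0" using that by simp
    moreover from this have "y = 0"
      using that(2) by (metis inner_eq_zero_iff inner_ge_zero mult_zero_right order_antisym zero_power2)
    ultimately show False using that(3) by (simp add: zero_prod_def)
  qed
  have "open U" unfolding U
    by (intro open_Collect_conj open_Collect_less continuous_intros)
  define Z where "Z = {p :: 'n xy_space. fst p \<ge> 0 \<and> snd p \<bullet> snd p \<le> 3 * (fst p)\<^sup>2 \<and> cubic_eval h p \<ge> 0}"
  have "closed Z" unfolding Z_def
    by (intro closed_Collect_conj closed_Collect_le continuous_intros)
  moreover have "U \<subseteq> Z" by (auto simp: U Z_def)
  ultimately have cl: "closure U \<subseteq> Z" by (rule closure_minimal[rotated])
  have "p \<in> U" if "p \<in> Z" "cubic_eval h p > 0" for p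
  proof -
    obtain x y where p: "p = (x, y)" by fastforce
    have "p \<noteq> 0" using that(2) by auto
    then have x: "x > 0" using that axis by (auto simp: p Z_def)
    moreover have "y \<bullet> y \<noteq> 3 * x\<^sup>2"
      using standard_form_null_nonpos[OF sf P x, of y] that(2) by (auto simp: p)
    ultimately show ?thesis using that by (auto simp: U Z_def p)
  qed
  then have 1: "frontier U - {0} \<subseteq> {p. fst p > 0 \<and> snd p \<bullet> snd p \<le> 3 * (fst p)\<^sup>2 \<and> cubic_eval h p = 0}"
    using cl \<open>open U\<close> axis by (force simp: frontier_def interior_open Z_def)
  have "(x, y) \<in> frontier U" if p: "x > 0" "y \<bullet> y \<le> 3 * x\<^sup>2" "cubic_eval h (x, y) = 0" for x y
  proof -
    have "((\<lambda>l. (x + l, y)) \<longlongrightarrow> (x + 0, y)) (at_right 0)"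
      by (intro tendsto_intros)
    moreover have "\<forall>\<^sub>F l in at_right 0. (x + l, y) \<in> closure U"
      using axis_shift_in_cone[OF sf _ p(2,3)] p(1) closure_subset[of U] unfolding eventually_at_right_field
      by (intro exI[of _ 1]) (auto simp: U subset_iff)
    ultimately have "(x + 0, y) \<in> closure U"
      by (intro Lim_in_closed_set[of "closure U" _ "at_right 0"]) auto
    then show ?thesis using p \<open>open U\<close> by (auto simp: frontier_def interior_open U)
  qed
  with 1 show ?thesis unfolding U_def[symmetric] by (auto simp: zero_prod_def)
qed

lemma tangent_space_zero_set_subset:
  assumes S: "S \<subseteq> {p. cubic_eval h p = 0}" and p: "cubic_eval h p = 0"
  shows "tangent_space S p \<subseteq> {v. tri h p p v = 0}"
proof
  fix v assume "v \<in> tangent_space S p"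
  then obtain \<gamma> :: "real \<Rightarrow> 'a" where g: "\<gamma> 0 = p" "\<forall>\<^sub>F t in at 0. \<gamma> t \<in> S"
    "(\<gamma> has_vector_derivative v) (at 0)" by (auto simp: tangent_space_def)
  have "((\<lambda>t. cubic_eval h (\<gamma> t)) has_derivative (\<lambda>t. 3 * tri h (\<gamma> 0) (\<gamma> 0) (t *\<^sub>R v))) (at 0)"
    using has_derivative_compose[OF g(3)[unfolded has_vector_derivative_def] cubic_eval_has_derivative] .
  moreover have "(\<lambda>t. 3 * tri h (\<gamma> 0) (\<gamma> 0) (t *\<^sub>R v)) = (*) (3 * tri h p p v)"
    by (simp add: g(1) tri_scale_right fun_eq_iff)
  ultimately have "((\<lambda>t. cubic_eval h (\<gamma> t)) has_real_derivative 3 * tri h p p v) (at 0)"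
    by (simp add: has_field_derivative_def)
  then have "((\<lambda>t. (cubic_eval h (\<gamma> t) - cubic_eval h (\<gamma> 0)) / t) \<longlongrightarrow> 3 * tri h p p v) (at 0)"
    by (simp add: DERIV_def)
  moreover have "\<forall>\<^sub>F t in at 0. (cubic_eval h (\<gamma> t) - cubic_eval h (\<gamma> 0)) / t = 0"
    using g(2) by (rule eventually_mono) (use S p in \<open>auto simp: g(1)\<close>)
  ultimately have "((\<lambda>t::real. 0::real) \<longlongrightarrow> 3 * tri h p p v) (at 0)"
    by (rule Lim_transform_eventually)
  then show "v \<in> {v. tri h p p v = 0}"
    by (simp add: tendsto_const_iff)
qed

lemma tangent_space_zero_set:
  fixes h :: "'n::finite xy_space cubic"
  assumes sf: "standard_form h P" and p: "x > 0" "y \<bullet> y < 3 * x\<^sup>2" "cubic_eval h (x, y) = 0"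
    and S: "S = {p. fst p > 0 \<and> snd p \<bullet> snd p \<le> 3 * (fst p)\<^sup>2 \<and> cubic_eval h p = 0}"
  shows "tangent_space S (x, y) = {v. tri h (x, y) (x, y) v = 0}"
proof
  show "tangent_space S (x, y) \<subseteq> {v. tri h (x, y) (x, y) v = 0}"
    by (rule tangent_space_zero_set_subset) (use S p in auto)
  show "{v. tri h (x, y) (x, y) v = 0} \<subseteq> tangent_space S (x, y)"
  proof
    fix v assume "v \<in> {v. tri h (x, y) (x, y) v = 0}"
    then have v: "tri h (x, y) (x, y) v = 0" by simp
    define p where "p = (x, y)"
    define o' :: "'n xy_space" where "o' = (1, 0)"
    define D where "D = 3 * x\<^sup>2 - y \<bullet> y"
    have D: "D > 0" using \<open>y \<bullet> y < 3 * x\<^sup>2\<close> by (simp add: D_def)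
    define \<phi> where "\<phi> = (\<lambda>q :: real \<times> real. 3 * tri h (p + fst q *\<^sub>R v) (p + fst q *\<^sub>R v) o' +
      3 * snd q * tri h (p + fst q *\<^sub>R v) o' o' + (snd q)\<^sup>2 * cubic_eval h o')"
    have exp: "cubic_eval h (p + t *\<^sub>R v + s *\<^sub>R o') = cubic_eval h (p + t *\<^sub>R v) + s * \<phi> (t, s)" for t s
      unfolding \<phi>_def cubic_eval_add_scale[of h "p + t *\<^sub>R v" s o']
      by (simp add: power2_eq_square power3_eq_cube algebra_simps)
    have \<phi>0: "\<phi> (0, 0) = D"
      unfolding \<phi>_def p_def o'_def D_def by (simp add: standard_form_tri[OF sf] power2_eq_square)
    have "continuous_on UNIV \<phi>" unfolding \<phi>_def by (intro continuous_intros)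
    then have "open {q. \<phi> q > D / 2}" by (intro open_Collect_less continuous_intros)
    moreover have "(0, 0) \<in> {q. \<phi> q > D / 2}" using D by (simp add: \<phi>0)
    ultimately obtain d where d: "d > 0" "ball (0, 0) d \<subseteq> {q. \<phi> q > D / 2}"
      by (meson open_contains_ball)
    have \<phi>: "\<phi> (t, s) > D / 2" if "\<bar>t\<bar> < d / 2" "\<bar>s\<bar> < d / 2" for t s
    proof -
      have "dist (0, 0) (t, s) \<le> \<bar>t\<bar> + \<bar>s\<bar>"
        by (simp add: dist_Pair_Pair dist_real_def sqrt_sum_squares_le_sum_abs)
      then show ?thesis using d(2) that by (auto simp: subset_iff)
    qed
    define K where "K = 3 * \<bar>tri h p v v\<bar> + \<bar>cubic_eval h v\<bar>"
    have K: "\<bar>cubic_eval h (p + t *\<^sub>R v)\<bar> \<le> K * t\<^sup>2" if "\<bar>t\<bar> \<le> 1" for t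
    proof -
      have "cubic_eval h (p + t *\<^sub>R v) = t\<^sup>2 * (3 * tri h p v v + t * cubic_eval h v)"
        unfolding cubic_eval_add_scale using v \<open>cubic_eval h (x, y) = 0\<close>
        by (simp add: p_def power2_eq_square power3_eq_cube algebra_simps)
      moreover have "\<bar>3 * tri h p v v + t * cubic_eval h v\<bar> \<le> K"
      proof -
        have "\<bar>t * cubic_eval h v\<bar> \<le> \<bar>cubic_eval h v\<bar>"
          using that by (simp add: abs_mult mult_left_le_one_le)
        then show ?thesis unfolding K_def by linarith
      qed
      ultimately show ?thesis
        by (simp add: abs_mult mult.commute[of K] mult_left_mono)
    qed
    define C where "C = 2 * K / D + 1"
    have C: "C > 0" "K \<le> C * (D / 2)"
      using D by (auto simp: C_def K_def field_simps intro!: add_nonneg_pos)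
    define \<delta> where "\<delta> = min 1 (min (d / 2) (d / (2 * C)))"
    have \<delta>: "\<delta> > 0" using d C by (simp add: \<delta>_def)
    have "\<exists>s. \<bar>s\<bar> \<le> C * t\<^sup>2 \<and> cubic_eval h (p + t *\<^sub>R v + s *\<^sub>R o') = 0" if t: "\<bar>t\<bar> < \<delta>" for t
    proof -
      have t1: "\<bar>t\<bar> \<le> 1" "\<bar>t\<bar> < d / 2" using t by (auto simp: \<delta>_def)
      have "C * t\<^sup>2 < d / 2"
      proof -
        have "t\<^sup>2 \<le> \<bar>t\<bar>" using t1(1) by (metis abs_ge_zero abs_mult_self_eq mult_left_le power2_eq_square)
        then have "C * t\<^sup>2 \<le> C * \<bar>t\<bar>" using C by simp
        also have "\<dots> < C * (d / (2 * C))"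
          using C t by (intro mult_strict_left_mono) (auto simp: \<delta>_def)
        also have "\<dots> = d / 2" using C by simp
        finally show ?thesis .
      qed
      moreover have "C * t\<^sup>2 \<ge> 0" using C by simp
      ultimately have s: "\<phi> (t, C * t\<^sup>2) > D / 2" "\<phi> (t, - (C * t\<^sup>2)) > D / 2"
        by (intro \<phi> t1(2); linarith)+
      have Kt: "K * t\<^sup>2 \<le> C * t\<^sup>2 * (D / 2)"
        using mult_right_mono[OF C(2), of "t\<^sup>2"] by (simp add: mult_ac)
      have le: "C * t\<^sup>2 * (D / 2) \<le> C * t\<^sup>2 * \<phi> (t, C * t\<^sup>2)" "C * t\<^sup>2 * (D / 2) \<le> C * t\<^sup>2 * \<phi> (t, - (C * t\<^sup>2))"
        using s C by (intro mult_left_mono; simp)+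
      define F where "F = (\<lambda>s. cubic_eval h (p + t *\<^sub>R v + s *\<^sub>R o'))"
      have "F (- (C * t\<^sup>2)) \<le> 0"
        unfolding F_def exp mult_minus_left using K[OF t1(1)] Kt le by linarith
      moreover have "0 \<le> F (C * t\<^sup>2)"
        unfolding F_def exp using K[OF t1(1)] Kt le by linarith
      moreover have "continuous_on {- (C * t\<^sup>2)..C * t\<^sup>2} F"
        unfolding F_def by (intro continuous_intros)
      ultimately obtain s where "- (C * t\<^sup>2) \<le> s" "s \<le> C * t\<^sup>2" "F s = 0"
        using IVT'[of F "- (C * t\<^sup>2)" 0 "C * t\<^sup>2"] C by auto
      then show ?thesis unfolding F_def by (intro exI[of _ s]) auto
    qed
    then obtain \<xi> where \<xi>: "\<And>t. \<bar>t\<bar> < \<delta> \<Longrightarrow> \<bar>\<xi> t\<bar> \<le> C * t\<^sup>2"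
      "\<And>t. \<bar>t\<bar> < \<delta> \<Longrightarrow> cubic_eval h (p + t *\<^sub>R v + \<xi> t *\<^sub>R o') = 0" by metis
    have \<xi>0: "\<xi> 0 = 0" using \<xi>(1)[of 0] \<delta> by simp
    have ev: "\<forall>\<^sub>F t in at 0. \<bar>t\<bar> < \<delta>"
      using \<delta> by (auto simp: eventually_at dist_real_def)
    have "((\<lambda>t. (\<xi> (0 + t) - \<xi> 0) / t) \<longlongrightarrow> 0) (at 0)"
    proof (rule Lim_null_comparison)
      show "\<forall>\<^sub>F t in at 0. norm ((\<xi> (0 + t) - \<xi> 0) / t) \<le> C * \<bar>t\<bar>"
        using ev
      proof (rule eventually_mono)
        fix t :: real assume t: "\<bar>t\<bar> < \<delta>"
        show "norm ((\<xi> (0 + t) - \<xi> 0) / t) \<le> C * \<bar>t\<bar>"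
          using \<xi>(1)[OF t] C by (cases "t = 0")
            (simp_all add: \<xi>0 divide_simps power2_eq_square mult.assoc)
      qed
      have "((\<lambda>t. C * \<bar>t\<bar>) \<longlongrightarrow> C * \<bar>0\<bar>) (at 0)" by (intro tendsto_intros)
      then show "((\<lambda>t. C * \<bar>t\<bar>) \<longlongrightarrow> 0) (at 0)" by simp
    qed
    then have \<xi>': "(\<xi> has_real_derivative 0) (at 0)" by (simp add: DERIV_def)
    define \<gamma> where "\<gamma> = (\<lambda>t. p + t *\<^sub>R v + \<xi> t *\<^sub>R o')"
    have \<gamma>': "(\<gamma> has_vector_derivative v) (at 0)"
      unfolding \<gamma>_def using \<xi>' by (auto intro!: derivative_eq_intros)
    have "isCont \<gamma> 0" using \<gamma>' by (rule has_vector_derivative_continuous)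
    then have lim: "(\<gamma> \<longlongrightarrow> p) (at 0)" by (simp add: isCont_def \<gamma>_def \<xi>0)
    have "open {q :: 'n xy_space. fst q > 0 \<and> snd q \<bullet> snd q < 3 * (fst q)\<^sup>2}"
      by (intro open_Collect_conj open_Collect_less continuous_intros)
    from topological_tendstoD[OF lim this]
    have "\<forall>\<^sub>F t in at 0. \<gamma> t \<in> {q. fst q > 0 \<and> snd q \<bullet> snd q < 3 * (fst q)\<^sup>2}"
      using \<open>x > 0\<close> \<open>y \<bullet> y < 3 * x\<^sup>2\<close> by (simp add: p_def)
    with ev have "\<forall>\<^sub>F t in at 0. \<gamma> t \<in> S"
      by (rule eventually_elim2) (use \<xi>(2) in \<open>auto simp: S \<gamma>_def\<close>)
    moreover have "\<gamma> 0 = (x, y)" by (simp add: \<gamma>_def \<xi>0 p_def)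
    ultimately show "v \<in> tangent_space S (x, y)"
      using \<gamma>' unfolding tangent_space_def by blast
  qed
qed

lemma regular_boundary_behaviour_interior:
  fixes h :: "'n::finite xy_space cubic"
  assumes sf: "standard_form h P" and P: "sup_sphere P < kappa"
  shows "regular_boundary_behaviour h (base_component h)"
proof -
  have Ple: "cubic_eval P y \<le> kappa * norm y ^ 3" for y
    using sup_sphere_le_iff[of P kappa] P by simp
  define S where "S = {p :: 'n xy_space. fst p > 0 \<and> snd p \<bullet> snd p \<le> 3 * (fst p)\<^sup>2 \<and> cubic_eval h p = 0}"
  have front: "frontier (spanned_cone (base_component h)) - {0} = S"
    unfolding S_def by (rule frontier_spanned_cone[OF sf Ple])
  have null: "cubic_eval h (x, y) < 0" if "x > 0" "y \<bullet> y = 3 * x\<^sup>2" for x y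
  proof -
    have ny: "norm y = sqrt 3 * x"
      using that by (simp add: norm_eq_sqrt_inner real_sqrt_mult)
    have "cubic_eval P y \<le> sup_sphere P * norm y ^ 3"
      using sup_sphere_le_iff[of P "sup_sphere P"] by simp
    also have "\<dots> < kappa * norm y ^ 3"
      using P that(1) by (intro mult_strict_right_mono) (auto simp: ny)
    also have "\<dots> = 2 * x ^ 3"
      unfolding ny power_mult_distrib by (simp add: power3_eq_cube)
    finally show ?thesis
      using sf that(2) by (simp add: standard_form_def power2_eq_square power3_eq_cube)
  qed
  have "(\<exists>v. tri h p p v \<noteq> 0) \<and> (\<forall>u\<in>tangent_space S p. tri h p u u \<le> 0) \<and>
      dim {u \<in> tangent_space S p. \<forall>v\<in>tangent_space S p. tri h p u v = 0} = 1" if "p \<in> S" for p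
  proof -
    obtain x y where pxy: "p = (x, y)" by fastforce
    have x: "x > 0" and hp: "cubic_eval h (x, y) = 0" and yle: "y \<bullet> y \<le> 3 * x\<^sup>2"
      using that by (auto simp: S_def pxy)
    then have y: "y \<bullet> y < 3 * x\<^sup>2" using null[of x y] by force
    define o' :: "'n xy_space" where "o' = (1, 0)"
    have ppo: "tri h p p o' > 0"
      using x y by (simp add: pxy o'_def standard_form_tri[OF sf] power2_eq_square)
    have E: "tangent_space S p = {v. tri h p p v = 0}"
      unfolding pxy by (rule tangent_space_zero_set[OF sf x y hp S_def])
    have neg: "tri h p u u \<le> 0" if u: "tri h p p u = 0" for u
    proof -
      define q where "q = (\<lambda>l::real. p + l *\<^sub>R o')"
      define w where "w = (\<lambda>l. u - (tri h (q l) (q l) u / tri h (q l) (q l) o') *\<^sub>R o')"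
      have qq: "q l = (x + l, y)" for l by (simp add: q_def pxy o'_def)
      have qo: "tri h (q l) (q l) o' > 0" if "l \<ge> 0" for l
      proof -
        have "x\<^sup>2 \<le> (x + l)\<^sup>2" using x that by (intro power_mono) auto
        then show ?thesis
          using y by (simp add: qq o'_def standard_form_tri[OF sf] power2_eq_square)
      qed
      have "continuous_on {0..} (\<lambda>l. tri h (q l) (w l) (w l))"
        unfolding w_def q_def
        by (intro continuous_intros) (use qo in \<open>auto simp: q_def less_imp_neq[symmetric]\<close>)
      then have "((\<lambda>l. tri h (q l) (w l) (w l)) \<longlongrightarrow> tri h (q 0) (w 0) (w 0)) (at 0 within {0..})"
        by (simp add: continuous_on_def)
      then have "((\<lambda>l. tri h (q l) (w l) (w l)) \<longlongrightarrow> tri h (q 0) (w 0) (w 0)) (at_right 0)"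
        by (rule tendsto_mono[rotated]) (auto intro: at_le)
      moreover have "\<forall>\<^sub>F l in at_right 0. tri h (q l) (w l) (w l) \<le> 0"
        unfolding eventually_at_right_field
      proof (intro exI[of _ 1] conjI allI impI)
        fix l :: real assume l: "0 < l"
        have "hyperbolic_point h (q l)"
          unfolding qq using axis_shift_in_cone[OF sf _ yle hp l] x
          by (intro standard_form_hyperbolic[OF sf Ple]) auto
        moreover have "tri h (q l) (q l) (w l) = 0"
          using qo[of l] l by (simp add: w_def tri_diff_right tri_scale_right)
        ultimately have "w l \<noteq> 0 \<longrightarrow> tri h (q l) (w l) (w l) < 0"
          unfolding hyperbolic_point_iff by blast
        then show "tri h (q l) (w l) (w l) \<le> 0"
          by (cases "w l = 0") auto
      qed simp
      ultimately have "tri h (q 0) (w 0) (w 0) \<le> 0"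
        by (intro tendsto_upperbound) auto
      then show ?thesis by (simp add: q_def w_def u)
    qed
    have "{u \<in> {v. tri h p p v = 0}. \<forall>v\<in>{v. tri h p p v = 0}. tri h p u v = 0} = span {p}" (is "?K = _")
    proof
      show "span {p} \<subseteq> ?K"
        using hp[folded pxy] by (auto simp: span_singleton tri_linear tri_diag)
      show "?K \<subseteq> span {p}"
      proof
        fix u assume u: "u \<in> ?K"
        define w where "w = u - (tri h p u o' / tri h p p o') *\<^sub>R p"
        have "tri h p w v = 0" for v
        proof -
          define s where "s = tri h p p v / tri h p p o'"
          have "tri h p p (v - s *\<^sub>R o') = 0"
            using ppo by (simp add: s_def tri_diff_right tri_scale_right)
          moreover from this have "tri h p u (v - s *\<^sub>R o') = 0" using u by blast
          ultimately have "tri h p w (v - s *\<^sub>R o') = 0"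
            by (simp add: w_def tri_diff_middle tri_scale_middle)
          moreover have "tri h p w o' = 0"
            using ppo by (simp add: w_def tri_diff_middle tri_scale_middle)
          ultimately show ?thesis by (simp add: tri_diff_right tri_scale_right)
        qed
        then have "w = 0"
          unfolding pxy using null hp by (intro timelike_kernel_trivial[OF sf x y]) auto
        then have "u = (tri h p u o' / tri h p p o') *\<^sub>R p" by (simp add: w_def)
        then show "u \<in> span {p}" by (metis span_base span_scale singletonI)
      qed
    qed
    moreover have "p \<noteq> 0" using x by (auto simp: pxy zero_prod_def)
    then have "dim (span {p}) = 1"
      using dim_eq_card_independent[of "{p}"] by (simp add: dim_span)
    ultimately have "dim {u \<in> tangent_space S p. \<forall>v\<in>tangent_space S p. tri h p u v = 0} = 1"
      unfolding E by simp
    moreover have "\<exists>v. tri h p p v \<noteq> 0" using ppo less_imp_neq[OF ppo] by metis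
    moreover have "\<forall>u\<in>tangent_space S p. tri h p u u \<le> 0" unfolding E using neg by simp
    ultimately show ?thesis by blast
  qed
  then show ?thesis
    unfolding regular_boundary_behaviour_iff front by blast
qed

text \<open>If \<open>P\<close> attains the critical value at \<open>e\<close>, then \<open>h\<close> has a double zero on the ray through
  \<open>(1, sqrt 3 e)\<close>, where \<open>dh\<close> vanishes.\<close>

lemma not_regular_boundary_behaviour_critical:
  fixes h :: "'n::finite xy_space cubic"
  assumes sf: "standard_form h P" and P: "sup_sphere P = kappa"
  shows "\<not> regular_boundary_behaviour h (base_component h)"
proof -
  have Ple: "cubic_eval P y \<le> kappa * norm y ^ 3" for y
    using sup_sphere_le_iff[of P kappa] P by simp
  obtain e where e: "norm e = 1" "cubic_eval P e = kappa"
    using sup_sphere_attained[of P] P by metis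
  have ee: "e \<bullet> e = 1" using e by (simp add: norm_eq_1)
  have grad: "3 * tri P e e v = 3 * kappa * (e \<bullet> v)" for v
  proof -
    define k where "k = kappa"
    define g where "g = (\<lambda>s. k * sqrt (1 + 2 * s * (e \<bullet> v) + s\<^sup>2 * (v \<bullet> v)) ^ 3 -
      (k + 3 * s * tri P e e v + 3 * s\<^sup>2 * tri P e v v + s ^ 3 * cubic_eval P v))"
    have "g s = kappa * norm (e + s *\<^sub>R v) ^ 3 - cubic_eval P (e + s *\<^sub>R v)" for s
      unfolding g_def k_def cubic_eval_add_scale e(2)
      by (simp add: norm_eq_sqrt_inner inner_add_left inner_add_right ee inner_commute[of v e]
          power2_eq_square algebra_simps)
    then have "g s \<ge> 0" for s using Ple by simp
    moreover have "g 0 = 0" by (simp add: g_def)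
    ultimately have "\<forall>s. \<bar>0 - s\<bar> < 1 \<longrightarrow> g 0 \<le> g s" by simp
    moreover have "(g has_real_derivative 3 * k * (e \<bullet> v) - 3 * tri P e e v) (at 0)"
      unfolding g_def by (auto intro!: derivative_eq_intros simp: field_simps)
    ultimately have "3 * k * (e \<bullet> v) - 3 * tri P e e v = 0"
      by (intro DERIV_local_min[of g _ 0 1]) auto
    then show ?thesis by (simp add: k_def)
  qed
  define p where "p = (1 :: real, sqrt 3 *\<^sub>R e)"
  have "tri h p p v = 0" for v
  proof -
    obtain a w where v: "v = (a, w)" by fastforce
    show ?thesis
      using grad[of w] unfolding v p_def standard_form_tri[OF sf]
      by (simp add: tri_linear ee field_simps)
  qed
  moreover from this have "cubic_eval h p = 0" by (metis tri_diag)
  then have "p \<in> frontier (spanned_cone (base_component h)) - {0}"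
    unfolding frontier_spanned_cone[OF sf Ple] by (simp add: p_def ee)
  ultimately show ?thesis
    unfolding regular_boundary_behaviour_iff by blast
qed

lemma generating_cubics_eq:
  "generating_cubics = {h. \<exists>P. standard_form h P \<and> sup_sphere P \<le> kappa}"
  by (simp add: generating_cubics_def sup_sphere_def)

lemma represents_exists:
  fixes h :: "'n::finite xy_space cubic"
  assumes "ccpsr_manifold h H"
  shows "\<exists>h'. represents h' h H"
proof -
  note H = assms[unfolded ccpsr_manifold_def psr_manifold_def]
  obtain p where p: "p \<in> H" using H by blast
  have "hyperbolic_point h p" using H p by blast
  moreover have "cubic_eval h p = 1"
    using H p openin_imp_subset by (fastforce simp: level_set_def)
  ultimately obtain A :: "'n xy_space \<Rightarrow> 'n xy_space" and h' P where
    A: "linear A" "bij A" "A (1, 0) = p" "cubic_eval h \<circ> A = cubic_eval h'" and sf: "standard_form h' P"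
    by (rule standard_form_exists)
  define H' where "H' = inv A ` H"
  have H': "A ` H' = H"
    unfolding H'_def using A(2) by (simp add: image_f_inv_f bij_is_surj)
  have eq: "psr_equivalent h H h' H'"
    unfolding psr_equivalent_def using A H' by blast
  have cc: "ccpsr_manifold h' H'" by (rule ccpsr_manifold_equivalent[OF eq assms])
  have base: "(1, 0) \<in> H'"
    unfolding H'_def using p A(2,3) by (metis bij_inv_eq_iff image_eqI)
  have "base_component h' = H'"
    unfolding base_component_def by (rule ccpsr_manifold_component[OF cc base])
  moreover have "sup_sphere P \<le> kappa"
    using sup_sphere_attained[of P] ccpsr_manifold_imp_bound[OF cc base sf] by metis
  ultimately have "represents h' h H"
    unfolding represents_def generating_cubics_eq using sf cc eq by auto
  then show ?thesis ..
qed

theorem theorem1p1: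
  fixes \<C> \<A> \<B> :: "'n::finite xy_space cubic set" and n :: nat
  defines "\<C> \<equiv> generating_cubics"
    and "\<A> \<equiv> standard_cubics"
    and "\<B> \<equiv> top_of_set \<A> frontier_of \<C>"
    and "n \<equiv> CARD('n)"
  shows
    "((\<forall>(h :: 'n xy_space cubic) H. ccpsr_manifold h H \<longrightarrow> (\<exists>h'. represents h' h H)) \<and>
      (\<forall>h\<in>\<C>. ccpsr_manifold h (base_component h))) \<and>
     (\<C> \<subseteq> \<A> \<and> affine \<A> \<and>
      real_of_int (aff_dim \<A>) = (real n ^ 3 + 3 * real n ^ 2 + 2 * real n) / 6 \<and>
      bounded \<C> \<and> compact \<C> \<and> convex \<C>) \<and>
     (\<exists>d. topological_submanifold d \<B>) \<and>
     (\<forall>h H h'. ccpsr_manifold h H \<and> represents h' h H \<longrightarrow>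
         (h' \<in> \<B> \<longleftrightarrow> \<not> regular_boundary_behaviour h H))"
proof -
  obtain h0 :: "'n xy_space cubic" and L where L: "linear L" "inj L"
    and sf: "\<And>h P. standard_form h P \<longleftrightarrow> h = h0 + L P"
    by (rule standard_form_parametrization) blast
  define \<Phi> where "\<Phi> = (\<lambda>P. h0 + L P)"
  have inj\<Phi>: "inj \<Phi>" using L(2) by (auto simp: \<Phi>_def inj_def)
  have \<C>: "\<C> = \<Phi> ` {P. sup_sphere P \<le> kappa}"
    unfolding \<C>_def generating_cubics_eq sf \<Phi>_def by auto
  have \<A>: "\<A> = \<Phi> ` UNIV"
    unfolding \<A>_def standard_cubics_def sf \<Phi>_def by auto
  then have \<A>': "\<A> = (+) h0 ` range L"
    by (auto simp: \<Phi>_def)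
  have sub: "subspace (range L)" using L(1) by (simp add: linear_subspace_image)
  have affine: "affine \<A>"
    unfolding \<A>' using sub affine_translation subspace_imp_affine by blast
  have "aff_dim \<A> = int (dim (range L))"
    unfolding \<A>' aff_dim_translation_eq by (rule aff_dim_subspace[OF sub])
  also have "dim (range L) = CARD((real ^ 'n) cubic_monomial)"
    using L by (simp add: dim_image_eq dim_UNIV)
  finally have "6 * real_of_int (aff_dim \<A>) = 6 * real ((n + 2) choose 3)"
    by (simp add: CARD_cubic_monomial n_def)
  then have dim: "real_of_int (aff_dim \<A>) = (real n ^ 3 + 3 * real n ^ 2 + 2 * real n) / 6"
    unfolding choose_three by simp
  have cont: "continuous_on X L" for X
    using L(1) by (simp add: linear_continuous_on linear_conv_bounded_linear)
  then have cont\<Phi>: "continuous_on X \<Phi>" for X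
    unfolding \<Phi>_def by (intro continuous_intros) auto
  have compact: "compact \<C>"
    unfolding \<C> by (intro compact_continuous_image cont\<Phi> compact_sup_sphere_le)
  have "\<C> = (+) h0 ` L ` {P. sup_sphere P \<le> kappa}"
    unfolding \<C> \<Phi>_def by auto
  then have convex: "convex \<C>"
    by (simp only:) (intro convex_translation convex_linear_image L convex_sup_sphere_le)
  obtain R where R: "linear R" "\<And>x. R (L x) = x"
    using linear_injective_left_inverse[OF L] by (metis comp_eq_dest_lhs id_apply)
  have "continuous_on \<A> (\<lambda>h. R (h - h0))"
    by (rule continuous_on_compose2[OF linear_continuous_on[of R UNIV]])
      (use R(1) in \<open>auto intro!: continuous_intros simp: linear_conv_bounded_linear\<close>)
  then have "homeomorphic_maps euclidean (top_of_set \<A>) \<Phi> (\<lambda>h. R (h - h0))"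
    unfolding homeomorphic_maps_def using cont\<Phi>
    by (auto simp: continuous_map_in_subtopology \<A> \<Phi>_def R)
  then have "homeomorphic_map euclidean (top_of_set \<A>) \<Phi>"
    unfolding homeomorphic_map_maps by blast
  then have "\<B> = \<Phi> ` frontier {P. sup_sphere P \<le> kappa}"
    unfolding \<B>_def \<C> by (subst homeomorphic_map_frontier_of) auto
  then have \<B>: "\<B> = \<Phi> ` {P. sup_sphere P = kappa}"
    by (simp add: frontier_sup_sphere_le)
  have "topological_submanifold (CARD((real ^ 'n) cubic_monomial) - 1) \<B>"
    unfolding \<B> \<Phi>_def
    by (rule topological_submanifold_gauge_sphere[OF L continuous_on_sup_sphere])
      (auto simp: sup_sphere_scale sup_sphere_pos)
  moreover have "ccpsr_manifold h (base_component h)" if "h \<in> \<C>" for h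
    using that ccpsr_manifold_base_component unfolding \<C>_def generating_cubics_eq sup_sphere_le_iff
    by blast
  moreover have "h' \<in> \<B> \<longleftrightarrow> \<not> regular_boundary_behaviour h H" if "represents h' h H" for h H h'
  proof -
    have "h' \<in> \<C>" and eq: "psr_equivalent h H h' (base_component h')"
      using that by (simp_all add: represents_def \<C>_def)
    then obtain P where P: "h' = \<Phi> P" "sup_sphere P \<le> kappa" unfolding \<C> by auto
    then have sf': "standard_form h' P" by (simp add: sf \<Phi>_def)
    have "h' \<in> \<B> \<longleftrightarrow> sup_sphere P = kappa"
      unfolding \<B> P(1) using inj\<Phi> by (simp add: inj_image_mem_iff)
    also have "\<dots> \<longleftrightarrow> \<not> regular_boundary_behaviour h' (base_component h')"
      using regular_boundary_behaviour_interior[OF sf'] not_regular_boundary_behaviour_critical[OF sf'] P(2)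
      by linarith
    finally show ?thesis
      using regular_boundary_behaviour_equivalent[OF eq] by simp
  qed
  moreover have "\<C> \<subseteq> \<A>" unfolding \<C> \<A> by auto
  ultimately show ?thesis
    using represents_exists affine dim compact compact_imp_bounded[OF compact] convex by blast
qed

end
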